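(* Let $\ell\ge2$ be an integer, let $\lambda\in(0,1)$, and let $\tau:\mathbb{R}/\mathbb{Z}\to\mathbb{R}$ be a function of class $\mathcal{C}$, where $\mathcal{C}$ is either the Lipschitz class or the class $C^r$ for some $r\in[0,\infty]\cup\{\omega\}$. Then the following are equivalent: (1) $A_{\lambda,\tau}$ is topologically conjugate to $A_{\lambda,0}$. (1') $A_{\lambda,\tau}$ is $\mathcal{C}$-conjugate to $A_{\lambda,0}$. (2) $\Omega_{\lambda,\tau}\subset\mathbb{R}/\mathbb{Z}\times\mathbb{R}$ is the graph of a continuous function $\mu:\mathbb{R}/\mathbb{Z}\to\mathbb{R}$. (2') $\Omega_{\lambda,\tau}\subset\mathbb{R}/\mathbb{Z}\times\mathbb{R}$ is the graph of a function $\mu:\mathbb{R}/\mathbb{Z}\to\mathbb{R}$ of class $\mathcal{C}$. (3) The functional equation $\mu\circ\mathbf{m}_\ell-\lambda\mu=\tau$ has a continuous solution $\mu:\mathbb{R}/\mathbb{Z}\to\mathbb{R}$. (3') The functional equation $\mu\circ\mathbf{m}_\ell-\lambda\mu=\tau$ has a solution $\mu:\mathbb{R}/\mathbb{Z}\to\mathbb{R}$ of class $\mathcal{C}$. (4) $\rho^+(\theta)=\rho^-(\theta)$ for all $\theta\in\mathbb{R}/\mathbb{Z}$. (5) $\rho^+(\theta)=\rho^-(\theta)$ for some $\theta\in\mathbb{R}/\mathbb{Z}$. (6) $\Omega_{\lambda,\tau}$ is a Jordan curve.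
   Context: $\mathbf{m}_\ell(\theta)=\ell\theta$ on $\mathbb{R}/\mathbb{Z}$. $A_{\lambda,\tau}:\mathbb{R}/\mathbb{Z}\times\mathbb{R}\to\mathbb{R}/\mathbb{Z}\times\mathbb{R}$ is $A_{\lambda,\tau}(\theta,t)=(\ell\theta,\lambda t+\tau(\theta))$ (so $A_{\lambda,0}(\theta,t)=(\ell\theta,\lambda t)$), and $\Omega_{\lambda,\tau}$ is its non-wandering set. $\rho^+(\theta)=\sup\{t:(\theta,t)\in\Omega_{\lambda,\tau}\}$ and $\rho^-(\theta)=\inf\{t:(\theta,t)\in\Omega_{\lambda,\tau}\}$. $C^\omega$ means real analytic. $\mathcal{C}$-conjugate means conjugate by a homeomorphism of the cylinder which together with its inverse is of class $\mathcal{C}$. A Jordan curve is a set homeomorphic to the circle. *)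

theory Defs
  imports "HOL-Analysis.Analysis"
begin

quotient_type circle = real / "\<lambda>x y :: real. x - y \<in> \<int>"
  morphisms circle_rep circle_of
proof (rule equivpI)
  show "reflp (\<lambda>x y :: real. x - y \<in> \<int>)"
    by (simp add: reflp_def)
  show "symp (\<lambda>x y :: real. x - y \<in> \<int>)"
    by (rule sympI) (metis Ints_minus minus_diff_eq)
  show "transp (\<lambda>x y :: real. x - y \<in> \<int>)"
  proof (rule transpI)
    fix x y z :: real
    assume "x - y \<in> \<int>" "y - z \<in> \<int>"
    then have "(x - y) + (y - z) \<in> \<int>" by (rule Ints_add)
    then show "x - z \<in> \<int>" by simp
  qed
qed

lemma circle_of_eq_iff: "circle_of x = circle_of y \<longleftrightarrow> x - y \<in> \<int>"
  by (simp add: circle.abs_eq_iff)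

lemma circle_exhaust: obtains x where "\<theta> = circle_of x"
  by (metis Quotient3_circle Quotient3_abs_rep)

lemma Ints_nonempty: "(\<int> :: real set) \<noteq> {}"
  using Ints_0 by blast

lemma infdist_Ints_shift:
  assumes "k \<in> \<int>"
  shows "infdist (x + k :: real) \<int> = infdist x \<int>"
proof -
  have "infdist (x + k) \<int> \<le> infdist x \<int>" if "k \<in> \<int>" for x k :: real
  proof -
    have "infdist (x + k) \<int> \<le> dist x a" if "a \<in> \<int>" for a
      using infdist_le[of "a + k" "\<int>" "x + k"] that \<open>k \<in> \<int>\<close> by (simp add: dist_real_def)
    then show ?thesis
      unfolding infdist_notempty[OF Ints_nonempty, of x] using Ints_0 by (intro cINF_greatest) auto
  qed
  from this[OF assms, of x] this[OF Ints_minus[OF assms], of "x + k"] show ?thesis by simp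
qed

text \<open>The topology is the quotient topology of the real line, and the distance of two classes is
  the least distance between representatives.\<close>

instantiation circle :: metric_space
begin

lift_definition dist_circle :: "circle \<Rightarrow> circle \<Rightarrow> real" is "\<lambda>x y. infdist (x - y) \<int>"
proof -
  fix x x' y y' :: real
  assume "x - x' \<in> \<int>" "y - y' \<in> \<int>"
  then have "(x - x') - (y - y') \<in> \<int>" by (rule Ints_diff)
  from infdist_Ints_shift[OF this, of "x' - y'"]
  show "infdist (x - y) \<int> = infdist (x' - y') \<int>"
    by (simp add: algebra_simps)
qed

definition uniformity_circle :: "(circle \<times> circle) filter" where
  "uniformity_circle = (INF e\<in>{0<..}. principal {(x, y). dist x y < e})"

definition open_circle :: "circle set \<Rightarrow> bool" where
  "open_circle U \<longleftrightarrow> open (circle_of -` U)"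

instance
proof
  show "uniformity = (INF e\<in>{0<..}. principal {(x :: circle, y). dist x y < e})"
    by (rule uniformity_circle_def)
  show zero: "dist \<theta> \<phi> = 0 \<longleftrightarrow> \<theta> = \<phi>" for \<theta> \<phi> :: circle
    by transfer (metis Ints_nonempty closed_Ints in_closed_iff_infdist_zero)
  have comm: "infdist (x - y :: real) \<int> \<le> infdist (y - x) \<int>" for x y
  proof -
    have "infdist (x - y) \<int> \<le> dist (y - x) a" if "a \<in> \<int>" for a
      using infdist_le[of "- a" "\<int>" "x - y"] that by (simp add: dist_real_def)
    then show ?thesis
      unfolding infdist_notempty[OF Ints_nonempty, of "y - x"] by (intro cINF_greatest) auto
  qed
  show "dist \<theta> \<phi> \<le> dist \<theta> \<psi> + dist \<phi> \<psi>" for \<theta> \<phi> \<psi> :: circle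
  proof transfer
    fix x y z :: real
    have "infdist (x - y) \<int> - infdist (x - z) \<int> \<le> dist (z - y) a" if "a \<in> \<int>" for a
    proof -
      have "infdist (x - y) \<int> = infdist ((x - y) + (- a)) \<int>"
        using infdist_Ints_shift[of "- a" "x - y"] that by simp
      also have "\<dots> \<le> infdist (x - z) \<int> + dist (x - y + - a) (x - z)"
        by (rule infdist_triangle)
      finally show ?thesis by (simp add: dist_real_def algebra_simps)
    qed
    then have "infdist (x - y) \<int> - infdist (x - z) \<int> \<le> infdist (z - y) \<int>"
      unfolding infdist_notempty[OF Ints_nonempty, of "z - y"] by (intro cINF_greatest) auto
    with comm[of z y] show "infdist (x - y) \<int> \<le> infdist (x - z) \<int> + infdist (y - z) \<int>" by simp
  qed
  show "open U \<longleftrightarrow> (\<forall>\<theta>\<in>U. \<forall>\<^sub>F (\<theta>', \<phi>) in uniformity. \<theta>' = \<theta> \<longrightarrow> \<phi> \<in> U)" for U :: "circle set"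
  proof -
    have *: "eventually P uniformity \<longleftrightarrow> (\<exists>e>0. \<forall>\<theta> \<phi>. dist \<theta> \<phi> < e \<longrightarrow> P (\<theta>, \<phi>))"
      for P :: "circle \<times> circle \<Rightarrow> bool"
      unfolding uniformity_circle_def
      by (subst eventually_INF_base)
         (auto simp: eventually_principal subset_eq intro: bexI[of _ "min _ _"])
    have near: "(\<forall>y. infdist (x - y) \<int> < e \<longrightarrow> circle_of y \<in> U) \<longleftrightarrow>
        (\<forall>y. dist y x < e \<longrightarrow> circle_of y \<in> U)" for x e :: real
    proof safe
      fix y assume "\<forall>y. infdist (x - y) \<int> < e \<longrightarrow> circle_of y \<in> U" "dist y x < e"
      moreover have "infdist (x - y) \<int> \<le> dist y x"
        using infdist_le[of 0 "\<int>" "x - y"] by (simp add: dist_real_def abs_minus_commute)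
      ultimately show "circle_of y \<in> U" by force
    next
      fix y assume h: "\<forall>y. dist y x < e \<longrightarrow> circle_of y \<in> U" "infdist (x - y) \<int> < e"
      then obtain a where a: "a \<in> \<int>" "dist (x - y) a < e"
        unfolding infdist_notempty[OF Ints_nonempty, of "x - y"]
        by (subst (asm) cINF_less_iff) auto
      then have "dist (y + a) x < e" by (simp add: dist_real_def abs_minus_commute algebra_simps)
      with h have "circle_of (y + a) \<in> U" by blast
      moreover have "circle_of (y + a) = circle_of y" using a by (simp add: circle_of_eq_iff)
      ultimately show "circle_of y \<in> U" by simp
    qed
    have "open U \<longleftrightarrow> (\<forall>x. circle_of x \<in> U \<longrightarrow> (\<exists>e>0. \<forall>y. dist y x < e \<longrightarrow> circle_of y \<in> U))"
      by (auto simp: open_circle_def open_dist)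
    also have "\<dots> \<longleftrightarrow> (\<forall>x. circle_of x \<in> U \<longrightarrow>
        (\<exists>e>0. \<forall>y. dist (circle_of x) (circle_of y) < e \<longrightarrow> circle_of y \<in> U))"
      by (simp add: dist_circle.abs_eq near)
    also have "\<dots> \<longleftrightarrow> (\<forall>\<theta>\<in>U. \<exists>e>0. \<forall>\<phi>. dist \<theta> \<phi> < e \<longrightarrow> \<phi> \<in> U)"
      by (metis circle_exhaust)
    finally show ?thesis unfolding * by auto
  qed
qed

end

lift_definition circle_mult :: "int \<Rightarrow> circle \<Rightarrow> circle" is "\<lambda>l x. of_int l * x"
  by (metis Ints_mult Ints_of_int right_diff_distrib)

type_synonym cylinder = "circle \<times> real"

text \<open>\<open>iterated_diff_on P k U f\<close>: the function \<open>f\<close> is \<open>k\<close> times differentiable on the open set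
  \<open>U\<close> and its \<open>k\<close>-fold iterated directional derivatives satisfy \<open>P\<close>.\<close>

primrec iterated_diff_on ::
  "(('a::euclidean_space \<Rightarrow> 'b::euclidean_space) \<Rightarrow> bool) \<Rightarrow> nat \<Rightarrow> 'a set \<Rightarrow> ('a \<Rightarrow> 'b) \<Rightarrow> bool" where
  "iterated_diff_on P 0 U f \<longleftrightarrow> P f"
| "iterated_diff_on P (Suc k) U f \<longleftrightarrow>
     (\<forall>x\<in>U. f differentiable (at x)) \<and>
     (\<forall>v. iterated_diff_on P k U (\<lambda>x. frechet_derivative f (at x) v))"

definition locally_Holder_on ::
  "real \<Rightarrow> 'a::metric_space set \<Rightarrow> ('a \<Rightarrow> 'b::metric_space) \<Rightarrow> bool" where
  "locally_Holder_on \<alpha> U f \<longleftrightarrow>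
     (\<forall>x\<in>U. \<exists>e>0. \<exists>C. \<forall>y \<in> U \<inter> ball x e. \<forall>z \<in> U \<inter> ball x e. dist (f y) (f z) \<le> C * dist y z powr \<alpha>)"

text \<open>Class $C^r$ for real \<open>r \<ge> 0\<close>. With \<open>k\<close> and \<open>\<alpha>\<close> the integer and fractional parts of \<open>r\<close>, this
  is the usual $C^k$ if \<open>\<alpha> = 0\<close>, and otherwise $C^k$ with locally \<open>\<alpha>\<close>-Hoelder derivatives of
  order \<open>k\<close>.\<close>

definition C_real_on ::
  "real \<Rightarrow> 'a::euclidean_space set \<Rightarrow> ('a \<Rightarrow> 'b::euclidean_space) \<Rightarrow> bool" where
  "C_real_on r U = iterated_diff_on
     (if frac r = 0 then continuous_on U else locally_Holder_on (frac r) U) (nat \<lfloor>r\<rfloor>) U"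

definition C_ext_on ::
  "ennreal \<Rightarrow> 'a::euclidean_space set \<Rightarrow> ('a \<Rightarrow> 'b::euclidean_space) \<Rightarrow> bool" where
  "C_ext_on r U f \<longleftrightarrow>
     (if r = \<infinity> then \<forall>k::nat. C_real_on (real k) U f else C_real_on (enn2real r) U f)"

text \<open>Local expansion as an unconditionally convergent multivariate power series; the elements of
  \<open>Basis \<rightarrow>\<^sub>E UNIV\<close> are the multi-indices.\<close>

definition real_analytic_on ::
  "'a::euclidean_space set \<Rightarrow> ('a \<Rightarrow> 'b::euclidean_space) \<Rightarrow> bool" where
  "real_analytic_on U f \<longleftrightarrow>
     (\<forall>x\<in>U. \<exists>e>0. \<exists>a :: ('a \<Rightarrow> nat) \<Rightarrow> 'b. \<forall>y \<in> U \<inter> ball x e.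
        ((\<lambda>m. (\<Prod>b\<in>Basis. ((y - x) \<bullet> b) ^ m b) *\<^sub>R a m) has_sum f y) (Basis \<rightarrow>\<^sub>E UNIV))"

datatype regularity = Lipschitz | C_ext ennreal | C_omega

text \<open>Differentiability on $R/Z$ and on the cylinder is read in the charts given by local inverses
  of the covering maps \<open>circle_of\<close> and \<open>cyl_of\<close>; Lipschitz is meant globally, for the
  metrics of \<open>circle\<close> and of the product \<open>circle \<times> real\<close>.\<close>

primrec circle_fun_of_class :: "regularity \<Rightarrow> (circle \<Rightarrow> real) \<Rightarrow> bool" where
  "circle_fun_of_class Lipschitz f \<longleftrightarrow> (\<exists>L. L-lipschitz_on UNIV f)"
| "circle_fun_of_class (C_ext r) f \<longleftrightarrow> C_ext_on r UNIV (f \<circ> circle_of)"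
| "circle_fun_of_class C_omega f \<longleftrightarrow> real_analytic_on UNIV (f \<circ> circle_of)"

definition cyl_of :: "real \<times> real \<Rightarrow> cylinder" where
  "cyl_of = (\<lambda>(x, t). (circle_of x, t))"

definition in_charts ::
  "((real \<times> real) set \<Rightarrow> (real \<times> real \<Rightarrow> real \<times> real) \<Rightarrow> bool) \<Rightarrow> (cylinder \<Rightarrow> cylinder) \<Rightarrow> bool" where
  "in_charts P H \<longleftrightarrow>
     (\<forall>p. \<exists>U F. open U \<and> p \<in> U \<and> (\<forall>q\<in>U. H (cyl_of q) = cyl_of (F q)) \<and> P U F)"

primrec cyl_map_of_class :: "regularity \<Rightarrow> (cylinder \<Rightarrow> cylinder) \<Rightarrow> bool" where
  "cyl_map_of_class Lipschitz H \<longleftrightarrow> (\<exists>L. L-lipschitz_on UNIV H)"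
| "cyl_map_of_class (C_ext r) H \<longleftrightarrow> in_charts (C_ext_on r) H"
| "cyl_map_of_class C_omega H \<longleftrightarrow> in_charts real_analytic_on H"

definition skew_map :: "int \<Rightarrow> real \<Rightarrow> (circle \<Rightarrow> real) \<Rightarrow> cylinder \<Rightarrow> cylinder" where
  "skew_map l lam \<tau> = (\<lambda>(\<theta>, t). (circle_mult l \<theta>, lam * t + \<tau> \<theta>))"

definition nonwandering_set :: "('a::topological_space \<Rightarrow> 'a) \<Rightarrow> 'a set" where
  "nonwandering_set f = {x. \<forall>U. open U \<and> x \<in> U \<longrightarrow> (\<exists>n\<ge>1. (f ^^ n) ` U \<inter> U \<noteq> {})}"

text \<open>The bounds of the fibres are taken in the extended reals, so that no convention is needed for
  empty or unbounded fibres.\<close>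

definition rho_plus :: "cylinder set \<Rightarrow> circle \<Rightarrow> ereal" where
  "rho_plus \<Omega> \<theta> = (SUP t\<in>{t. (\<theta>, t) \<in> \<Omega>}. ereal t)"

definition rho_minus :: "cylinder set \<Rightarrow> circle \<Rightarrow> ereal" where
  "rho_minus \<Omega> \<theta> = (INF t\<in>{t. (\<theta>, t) \<in> \<Omega>}. ereal t)"

definition topologically_conjugate ::
  "('a::topological_space \<Rightarrow> 'a) \<Rightarrow> ('b::topological_space \<Rightarrow> 'b) \<Rightarrow> bool" where
  "topologically_conjugate f g \<longleftrightarrow> (\<exists>h h'. homeomorphism UNIV UNIV h h' \<and> h \<circ> f = g \<circ> h)"

definition conjugate_of_class ::
  "regularity \<Rightarrow> (cylinder \<Rightarrow> cylinder) \<Rightarrow> (cylinder \<Rightarrow> cylinder) \<Rightarrow> bool" where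
  "conjugate_of_class \<C> f g \<longleftrightarrow>
     (\<exists>h h'. homeomorphism UNIV UNIV h h' \<and> cyl_map_of_class \<C> h \<and> cyl_map_of_class \<C> h' \<and>
             h \<circ> f = g \<circ> h)"

definition graph_of :: "('a \<Rightarrow> 'b) \<Rightarrow> ('a \<times> 'b) set" where
  "graph_of \<mu> = {(\<theta>, \<mu> \<theta>) | \<theta>. True}"

definition solves_functional_eq :: "int \<Rightarrow> real \<Rightarrow> (circle \<Rightarrow> real) \<Rightarrow> (circle \<Rightarrow> real) \<Rightarrow> bool" where
  "solves_functional_eq l lam \<tau> \<mu> \<longleftrightarrow> (\<forall>\<theta>. \<mu> (circle_mult l \<theta>) - lam * \<mu> \<theta> = \<tau> \<theta>)"

definition jordan_curve :: "'a::topological_space set \<Rightarrow> bool" where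
  "jordan_curve S \<longleftrightarrow> S homeomorphic sphere (0::complex) 1"

end

theory Submission
  imports Defs "HOL-Complex_Analysis.Complex_Analysis"
begin

text \<open>The proof closes the cycle (1), (6), (5), (3), (3'), (1'), (1), together with
  (3') to (2') to (2) to (4) to (5).

  The upper boundary \<open>\<rho>\<^sup>+\<close> of \<open>\<Omega>\<close> is the fixed point of the contraction
  \<open>\<rho> \<mapsto> (\<theta> \<mapsto> max {lam * \<rho> \<phi> + \<tau> \<phi> | l\<phi> = \<theta>})\<close> on continuous functions, and \<open>\<rho>\<^sup>-\<close> is obtained
  from it by a sign change; so both are continuous and their graphs lie in \<open>\<Omega>\<close>. If they never met,
  they would be two disjoint Jordan curves inside \<open>\<Omega>\<close>, which a Jordan curve cannot contain. If they
  meet over one point, then they meet over the dense set of its iterated preimages, hence everywhere,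
  and their common value solves the functional equation.

  For the regularity, lift the functional equation to the line as
  \<open>f x = lam * f (x / l) + g (x / l)\<close>. Differentiation preserves the form of this equation (with
  \<open>lam / l\<close> in place of \<open>lam\<close>), and the contraction \<open>x \<mapsto> x / l\<close> reduces Hoelder continuity and
  analyticity to a neighbourhood of \<open>0\<close>. A solution \<open>\<mu>\<close> gives the conjugacy
  \<open>(\<theta>, t) \<mapsto> (\<theta>, t - \<mu> \<theta>)\<close>.\<close>

section \<open>The circle\<close>

lemma dist_circle_of_le: "dist (circle_of x) (circle_of y) \<le> dist x y"
  using infdist_le[of 0 "\<int>" "x - y"] by (simp add: dist_circle.abs_eq dist_real_def)

text \<open>The integers are closed, so the infimum defining the distance is attained, and the
  nearest integer can be absorbed into one representative. Lipschitz bounds on the line then descend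
  to the circle with the same constant.\<close>

lemma circle_dist_attained:
  obtains x y where "\<theta> = circle_of x" "\<phi> = circle_of y" "dist \<theta> \<phi> = dist x y"
proof -
  obtain x y where xy: "\<theta> = circle_of x" "\<phi> = circle_of y"
    using circle_exhaust by metis
  obtain k where k: "k \<in> \<int>" "infdist (x - y) \<int> = dist (x - y) k"
    using infdist_attains_inf[OF closed_Ints Ints_nonempty] by metis
  have "\<phi> = circle_of (y + k)"
    using xy k(1) by (simp add: circle_of_eq_iff)
  moreover have "dist \<theta> \<phi> = dist x (y + k)"
    using xy k(2) by (simp add: dist_circle.abs_eq dist_real_def algebra_simps)
  ultimately show ?thesis
    using that xy by blast
qed

lemma continuous_on_circle_of [continuous_intros]:
  assumes "continuous_on S f"
  shows "continuous_on S (\<lambda>x. circle_of (f x))"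
proof -
  have "1-lipschitz_on UNIV circle_of"
    by (intro lipschitz_onI) (simp_all add: dist_circle_of_le)
  then have "continuous_on UNIV circle_of"
    by (rule lipschitz_on_continuous_on)
  then show ?thesis
    by (rule continuous_on_compose2) (use assms in auto)
qed

text \<open>The topology is by definition the quotient topology, so openness of preimages may be
  tested on the line.\<close>

lemma continuous_on_circle_iff:
  fixes f :: "circle \<Rightarrow> 'a::topological_space"
  shows "continuous_on UNIV f \<longleftrightarrow> continuous_on UNIV (\<lambda>x. f (circle_of x))"
proof
  assume "continuous_on UNIV f"
  then show "continuous_on UNIV (\<lambda>x. f (circle_of x))"
    by (rule continuous_on_compose2) (auto intro!: continuous_intros)
next
  assume "continuous_on UNIV (\<lambda>x. f (circle_of x))"
  then show "continuous_on UNIV f"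
    by (simp add: continuous_on_open_vimage open_circle_def vimage_def)
qed

lemma compact_UNIV_circle: "compact (UNIV :: circle set)"
proof -
  have "\<theta> \<in> circle_of ` {0..1}" for \<theta>
  proof -
    obtain x where "\<theta> = circle_of x" by (rule circle_exhaust)
    then have "\<theta> = circle_of (frac x)"
      by (simp add: circle_of_eq_iff frac_def)
    then show ?thesis
      using frac_ge_0[of x] frac_lt_1[of x] by (intro image_eqI[of _ _ "frac x"]) auto
  qed
  then have "(UNIV :: circle set) = circle_of ` {0..1}"
    by blast
  moreover have "compact (circle_of ` {0..1})"
    by (intro compact_continuous_image continuous_intros) auto
  ultimately show ?thesis by simp
qed

lemma continuous_circle_bounded:
  fixes f :: "circle \<Rightarrow> real"
  assumes "continuous_on UNIV f"
  obtains M where "M > 0" "\<And>\<theta>. \<bar>f \<theta>\<bar> \<le> M"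
proof -
  have "bounded (range f)"
    using compact_continuous_image[OF assms compact_UNIV_circle] by (rule compact_imp_bounded)
  then show ?thesis
    using that by (auto simp: bounded_pos)
qed

section \<open>The expanding map of the circle\<close>

lemma circle_mult_circle_of [simp]: "circle_mult l (circle_of x) = circle_of (of_int l * x)"
  by (rule circle_mult.abs_eq)

lemma continuous_on_circle_mult [continuous_intros]:
  assumes "continuous_on S f"
  shows "continuous_on S (\<lambda>x. circle_mult l (f x))"
proof -
  have "continuous_on UNIV (circle_mult l)"
    by (subst continuous_on_circle_iff) (auto intro!: continuous_intros)
  then show ?thesis
    by (rule continuous_on_compose2) (use assms in auto)
qed

lemma circle_mult_funpow:
  "(circle_mult l ^^ n) (circle_of x) = circle_of (of_int l ^ n * x)"
  by (induction n) (simp_all add: mult.assoc)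

lemma circle_mult_fibre_eq:
  assumes "l > 0"
  shows "{\<phi>. circle_mult l \<phi> = circle_of x} = (\<lambda>j. circle_of ((x + of_int j) / of_int l)) ` {0..<l}"
proof (intro equalityI subsetI)
  fix \<phi> assume "\<phi> \<in> {\<phi>. circle_mult l \<phi> = circle_of x}"
  moreover obtain y where y: "\<phi> = circle_of y" by (rule circle_exhaust)
  ultimately obtain k where k: "of_int l * y - x = of_int k"
    by (auto simp: circle_of_eq_iff Ints_def)
  \<comment> \<open>Division with remainder: \<open>k mod l\<close> selects the branch, while
    \<open>k div l\<close> is an integer shift that vanishes on the circle.\<close>
  have "y = (x + of_int (k mod l)) / of_int l + of_int (k div l)"
  proof -
    have "of_int k = (of_int (l * (k div l) + k mod l) :: real)"
      by simp
    then have "of_int k = of_int l * (of_int (k div l) :: real) + of_int (k mod l)"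
      unfolding of_int_add of_int_mult .
    with k have "of_int l * y = x + of_int (k mod l) + of_int l * of_int (k div l)"
      by simp
    with assms show ?thesis
      by (simp add: field_simps)
  qed
  then have "\<phi> = circle_of ((x + of_int (k mod l)) / of_int l)"
    using y by (simp add: circle_of_eq_iff)
  with assms show "\<phi> \<in> (\<lambda>j. circle_of ((x + of_int j) / of_int l)) ` {0..<l}"
    by auto
next
  fix \<phi> assume "\<phi> \<in> (\<lambda>j. circle_of ((x + of_int j) / of_int l)) ` {0..<l}"
  with assms show "\<phi> \<in> {\<phi>. circle_mult l \<phi> = circle_of x}"
    by (auto simp: circle_of_eq_iff)
qed

lemma surj_circle_mult:
  assumes "l > 0"
  obtains \<phi> where "circle_mult l \<phi> = \<theta>"
proof -
  obtain x where "\<theta> = circle_of x" by (rule circle_exhaust)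
  with assms have "circle_mult l (circle_of (x / of_int l)) = \<theta>" by simp
  then show ?thesis by (rule that)
qed

text \<open>On the line, the preimages of a point under the N-th iterate are spaced 1 / l^N apart,
  so they meet any ball whose radius exceeds 1 / l^N.\<close>

lemma circle_mult_locally_eventually_onto:
  assumes l: "l \<ge> 2" and U: "open U" "\<theta> \<in> U"
  obtains N where "N \<ge> 1" "\<And>\<phi>. \<exists>\<psi>\<in>U. (circle_mult l ^^ N) \<psi> = \<phi>"
proof -
  obtain x where x: "\<theta> = circle_of x" by (rule circle_exhaust)
  with U obtain e where e: "e > 0" "\<And>y. dist y x < e \<Longrightarrow> circle_of y \<in> U"
    by (force simp: open_circle_def open_dist)
  have l1: "(of_int l :: real) > 1" using l by simp
  obtain N where N: "1 / e < of_int l ^ N"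
    using real_arch_pow[OF l1] by blast
  \<comment> \<open>Passing to \<open>Suc N\<close> secures an exponent of at least 1, as the
    definition of a non-wandering point demands of a return time.\<close>
  also have "of_int l ^ N \<le> (of_int l ^ Suc N :: real)"
    using l1 by (intro power_increasing) auto
  finally have N: "1 / of_int l ^ Suc N < e"
    using e(1) l1 by (simp add: field_simps)
  have "\<exists>\<psi>\<in>U. (circle_mult l ^^ Suc N) \<psi> = \<phi>" for \<phi>
  proof -
    let ?L = "of_int l ^ Suc N :: real"
    have L: "?L > 0" using l1 by simp
    obtain y where y: "\<phi> = circle_of y" by (rule circle_exhaust)
    \<comment> \<open>This shift moves the representative of \<phi> to within 1 of l^(Suc N) * x;
      division by l^(Suc N) brings it close to x.\<close>
    define k where "k = \<lfloor>?L * x - y\<rfloor>"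
    have "\<bar>(y + of_int k) - ?L * x\<bar> \<le> 1"
      unfolding k_def by linarith
    then have "\<bar>(y + of_int k) - ?L * x\<bar> / ?L \<le> 1 / ?L"
      using L by (intro divide_right_mono) simp_all
    moreover have "(y + of_int k) / ?L - x = ((y + of_int k) - ?L * x) / ?L"
      using L by (simp only: diff_divide_distrib nonzero_mult_div_cancel_left less_imp_neq[symmetric] not_False_eq_True)
    then have "\<bar>(y + of_int k) / ?L - x\<bar> = \<bar>(y + of_int k) - ?L * x\<bar> / ?L"
      using L by (simp only: abs_divide abs_of_pos)
    ultimately have "\<bar>(y + of_int k) / ?L - x\<bar> \<le> 1 / ?L"
      by (simp only:)
    then have "circle_of ((y + of_int k) / ?L) \<in> U"
      using N by (intro e(2)) (simp add: dist_real_def)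
    moreover have "(circle_mult l ^^ Suc N) (circle_of ((y + of_int k) / ?L)) = \<phi>"
      unfolding circle_mult_funpow y circle_of_eq_iff using L l by simp
    ultimately show ?thesis by blast
  qed
  then show ?thesis using that[of "Suc N"] by simp
qed

section \<open>Maps from the circle to the line and to the unit circle\<close>

lemma circle_homeomorphic_sphere: "(UNIV :: circle set) homeomorphic sphere (0::complex) 1"
proof -
  \<comment> \<open>\<open>circle_rep\<close> picks an arbitrary representative; the periodicity of
    \<open>cis\<close> makes \<open>E\<close> independent of that choice. As a continuous bijection
    from a compact space, \<open>E\<close> is a homeomorphism.\<close>
  define E :: "circle \<Rightarrow> complex" where "E \<theta> = cis (2 * pi * circle_rep \<theta>)" for \<theta>
  have E: "E (circle_of x) = cis (2 * pi * x)" for x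
  proof -
    have "circle_of (circle_rep (circle_of x)) = circle_of x"
      by (rule Quotient3_abs_rep[OF Quotient3_circle])
    then obtain k where k: "circle_rep (circle_of x) = x + of_int k"
      unfolding circle_of_eq_iff by (auto simp: Ints_def algebra_simps)
    have "cis (2 * pi * (x + of_int k)) = cis (2 * pi * x) * cis (2 * pi * of_int k)"
      by (simp only: cis_mult distrib_left)
    also have "\<dots> = cis (2 * pi * x)"
      by (simp add: cis_multiple_2pi)
    finally show ?thesis
      by (simp only: E_def k)
  qed
  have "continuous_on UNIV E"
    unfolding continuous_on_circle_iff E by (intro continuous_intros)
  moreover have "range E = sphere 0 1"
  proof (intro equalityI subsetI)
    fix z :: complex assume "z \<in> sphere 0 1"
    then have "z = E (circle_of (Arg z / (2 * pi)))"
      using E cis_Arg_unique rcis_cmod_Arg[of z] by (simp add: rcis_def)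
    then show "z \<in> range E" by blast
  qed (auto simp: E_def)
  moreover have "inj E"
  proof (rule injI)
    fix \<theta> \<phi> assume eq: "E \<theta> = E \<phi>"
    obtain x y where xy: "\<theta> = circle_of x" "\<phi> = circle_of y"
      using circle_exhaust by metis
    from eq have "exp (\<i> * of_real (2 * pi * x)) = exp (\<i> * of_real (2 * pi * y))"
      unfolding xy E cis_conv_exp .
    then obtain n :: int where "\<i> * of_real (2 * pi * x) = \<i> * of_real (2 * pi * y) + of_int (2 * n) * pi * \<i>"
      unfolding exp_eq by blast
    then have "2 * pi * x = 2 * pi * y + of_int (2 * n) * pi"
      by (simp add: complex_eq_iff)
    then have "2 * pi * (x - y) = 2 * pi * of_int n" by (simp add: algebra_simps)
    then have "x - y = of_int n" by simp
    then show "\<theta> = \<phi>" by (simp add: xy circle_of_eq_iff)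
  qed
  ultimately show ?thesis
    using homeomorphic_compact[OF compact_UNIV_circle] by blast
qed

text \<open>The one-dimensional Borsuk-Ulam argument: the difference \<open>D\<close> of the values
  at antipodal points changes sign over half a turn, so it vanishes somewhere.\<close>

lemma continuous_circle_to_real_not_inj:
  fixes g :: "circle \<Rightarrow> real"
  assumes "continuous_on UNIV g"
  shows "\<not> inj g"
proof
  assume "inj g"
  define D where "D x = g (circle_of (x + 1 / 2)) - g (circle_of x)" for x
  have "continuous_on UNIV (\<lambda>x. g (circle_of x))"
    using assms by (simp add: continuous_on_circle_iff)
  then have cont: "continuous_on A D" for A
    unfolding D_def
    by (intro continuous_on_diff continuous_on_compose2[OF assms] continuous_intros) auto
  have "circle_of (1 / 2 + 1 / 2) = circle_of 0"
    by (simp add: circle_of_eq_iff)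
  then have D: "D (1 / 2) = - D 0"
    by (simp add: D_def)
  have "\<exists>x. D x = 0"
  proof (cases "D 0 \<le> 0")
    case True
    then show ?thesis
      using IVT'[of D 0 0 "1 / 2"] cont D by auto
  next
    case False
    then show ?thesis
      using IVT2'[of D "1 / 2" 0 0] cont D by auto
  qed
  then obtain x where "g (circle_of (x + 1 / 2)) = g (circle_of x)"
    by (auto simp: D_def)
  with \<open>inj g\<close> have "(1 / 2 :: real) \<in> \<int>"
    by (auto dest!: injD simp: circle_of_eq_iff)
  then obtain k :: int where "1 / 2 = (of_int k :: real)"
    by (auto simp: Ints_def)
  then have "of_int (2 * k) = (of_int 1 :: real)" by simp
  then have "2 * k = 1" by (simp only: of_int_eq_iff)
  then show False by presburger
qed

text \<open>If z were missed, the target could be cut open at z, and a branch of the argument would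
  embed the circle in the line.\<close>

lemma inj_continuous_circle_to_sphere_surj:
  fixes \<Phi> :: "circle \<Rightarrow> complex"
  assumes cont: "continuous_on UNIV \<Phi>" and inj: "inj \<Phi>" and sph: "\<And>\<theta>. norm (\<Phi> \<theta>) = 1"
    and z: "norm z = 1"
  shows "z \<in> range \<Phi>"
proof (rule ccontr)
  assume nin: "z \<notin> range \<Phi>"
  \<comment> \<open>This rotation carries z to -1, the only point of the unit circle on the cut of
    \<open>Arg\<close>.\<close>
  define w where "w \<theta> = - \<Phi> \<theta> / z" for \<theta>
  have z0: "z \<noteq> 0" using z by auto
  have w1: "norm (w \<theta>) = 1" for \<theta>
    by (simp add: w_def norm_divide sph z)
  have "w \<theta> \<notin> \<real>\<^sub>\<le>\<^sub>0" for \<theta>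
  proof
    assume "w \<theta> \<in> \<real>\<^sub>\<le>\<^sub>0"
    then obtain r where r: "w \<theta> = of_real r" "r \<le> 0"
      by (elim nonpos_Reals_cases)
    with w1[of \<theta>] have "r = - 1" by simp
    with r z0 have "\<Phi> \<theta> = z" by (simp add: w_def field_simps)
    with nin show False by blast
  qed
  then have "continuous_on UNIV (\<lambda>\<theta>. Arg (w \<theta>))"
    unfolding w_def using z0
    by (intro continuous_on_Arg' continuous_intros cont) auto
  moreover have "inj (\<lambda>\<theta>. Arg (w \<theta>))"
  proof (rule injI)
    fix \<theta> \<phi> assume "Arg (w \<theta>) = Arg (w \<phi>)"
    then have "w \<theta> = w \<phi>"
      using rcis_cmod_Arg[of "w \<theta>"] rcis_cmod_Arg[of "w \<phi>"] by (simp add: w1)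
    with z0 have "\<Phi> \<theta> = \<Phi> \<phi>" by (simp add: w_def)
    with inj show "\<theta> = \<phi>" by (rule injD)
  qed
  ultimately show False
    using continuous_circle_to_real_not_inj by blast
qed

section \<open>Regularity of solutions on the line\<close>

lemma abs_divide_le_self:
  fixes x c :: real
  assumes "c \<ge> 1"
  shows "\<bar>x / c\<bar> \<le> \<bar>x\<bar>"
  using frac_le[of "\<bar>x\<bar>" "\<bar>x\<bar>" 1 c] assms by simp

text \<open>Each use of the equation adds one term to a geometric series of ratio lam and shrinks
  the crude bound 2 * M by lam. With \<open>S = UNIV\<close> and exponent 1 this settles the
  Lipschitz class, with a ball about 0 the local Hoelder condition.\<close>

lemma holder_solution:
  fixes f g :: "real \<Rightarrow> real"
  assumes lam: "0 < lam" "lam < 1" and L: "L > 1" and \<alpha>: "\<alpha> \<ge> 0" and C: "C \<ge> 0"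
    and eq: "\<And>x. f x = lam * f (x / L) + g (x / L)"
    and S: "\<And>x. x \<in> S \<Longrightarrow> x / L \<in> S" and M: "\<And>x. x \<in> S \<Longrightarrow> \<bar>f x\<bar> \<le> M"
    and g: "\<And>x y. x \<in> S \<Longrightarrow> y \<in> S \<Longrightarrow> \<bar>g x - g y\<bar> \<le> C * \<bar>x - y\<bar> powr \<alpha>"
    and xy: "x \<in> S" "y \<in> S"
  shows "\<bar>f x - f y\<bar> \<le> C / (1 - lam) * \<bar>x - y\<bar> powr \<alpha>"
proof -
  \<comment> \<open>K is the fixed point of the map taking K to lam * K + C, so the bound reproduces
    itself under the equation.\<close>
  define K where "K = C / (1 - lam)"
  have K: "K \<ge> 0" "lam * K + C = K"
    using C lam by (simp_all add: K_def field_simps)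
  have iter: "\<bar>f x - f y\<bar> \<le> K * \<bar>x - y\<bar> powr \<alpha> + lam ^ n * (2 * M)" if "x \<in> S" "y \<in> S" for n x y
    using that
  proof (induction n arbitrary: x y)
    case 0
    have "0 \<le> K * \<bar>x - y\<bar> powr \<alpha>" using K by simp
    with M[OF 0(1)] M[OF 0(2)] show ?case by simp
  next
    case (Suc n)
    have shrink: "\<bar>x / L - y / L\<bar> powr \<alpha> \<le> \<bar>x - y\<bar> powr \<alpha>"
    proof (rule powr_mono2)
      show "\<bar>x / L - y / L\<bar> \<le> \<bar>x - y\<bar>"
        using L abs_divide_le_self[of L "x - y"] by (simp only: diff_divide_distrib)
    qed (use \<alpha> in auto)
    have "\<bar>f x - f y\<bar> \<le> lam * \<bar>f (x / L) - f (y / L)\<bar> + \<bar>g (x / L) - g (y / L)\<bar>"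
    proof -
      have "f x - f y = lam * (f (x / L) - f (y / L)) + (g (x / L) - g (y / L))"
        using eq[of x] eq[of y] by (simp add: algebra_simps)
      then show ?thesis
        using abs_triangle_ineq lam by (metis abs_mult abs_of_pos)
    qed
    also have "\<dots> \<le> lam * (K * \<bar>x / L - y / L\<bar> powr \<alpha> + lam ^ n * (2 * M)) + C * \<bar>x / L - y / L\<bar> powr \<alpha>"
      using Suc S lam by (intro add_mono mult_left_mono g) auto
    also have "\<dots> \<le> lam * (K * \<bar>x - y\<bar> powr \<alpha> + lam ^ n * (2 * M)) + C * \<bar>x - y\<bar> powr \<alpha>"
      using shrink lam K C by (intro add_mono mult_left_mono) auto
    also have "\<dots> = (lam * K + C) * \<bar>x - y\<bar> powr \<alpha> + lam ^ Suc n * (2 * M)"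
      by (simp add: algebra_simps)
    finally show ?case by (simp only: K)
  qed
  have "(\<lambda>n. K * \<bar>x - y\<bar> powr \<alpha> + lam ^ n * (2 * M)) \<longlonglongrightarrow> K * \<bar>x - y\<bar> powr \<alpha> + 0"
    using lam by (intro tendsto_add tendsto_const tendsto_mult_left_zero LIMSEQ_power_zero) auto
  then show ?thesis
    using iter[OF xy] unfolding K_def by (intro LIMSEQ_le_const) auto
qed

text \<open>Every orbit of the contraction ends up near its fixed point \<open>0\<close>.\<close>

lemma scaling_induct:
  fixes L :: real
  assumes L: "L > 1" and e: "e > 0" and near: "\<And>x. \<bar>x\<bar> < e \<Longrightarrow> Q x"
    and step: "\<And>x. Q (x / L) \<Longrightarrow> Q x"
  shows "Q x"
proof -
  have "Q x" if "Q (x / L ^ n)" for n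
    using that
  proof (induction n arbitrary: x)
    case (Suc n)
    then have "Q (x / L)" by simp
    then show ?case by (rule step)
  qed simp
  moreover have "(\<lambda>n. x / L ^ n) \<longlonglongrightarrow> 0"
    using L by (rule LIMSEQ_divide_realpow_zero)
  then have "\<forall>\<^sub>F n in sequentially. dist (x / L ^ n) 0 < e"
    using e by (rule tendstoD)
  then obtain n where "\<bar>x / L ^ n\<bar> < e"
    by (auto simp: eventually_sequentially dist_real_def)
  ultimately show ?thesis using near by blast
qed

lemma locally_Holder_onE:
  assumes "locally_Holder_on \<alpha> U f" "x \<in> U"
  obtains e C where "e > 0" "C \<ge> 0"
    "\<And>y z. y \<in> U \<inter> ball x e \<Longrightarrow> z \<in> U \<inter> ball x e \<Longrightarrow> dist (f y) (f z) \<le> C * dist y z powr \<alpha>"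
proof -
  from assms obtain e C where e: "e > 0"
    and C: "\<And>y z. y \<in> U \<inter> ball x e \<Longrightarrow> z \<in> U \<inter> ball x e \<Longrightarrow> dist (f y) (f z) \<le> C * dist y z powr \<alpha>"
    unfolding locally_Holder_on_def by meson
  have "C * dist y z powr \<alpha> \<le> max C 0 * dist y z powr \<alpha>" for y z :: 'a
    by (intro mult_right_mono) auto
  with C show ?thesis
    using e that[of e "max C 0"] by (meson max.cobounded2 order_trans)
qed

lemma locally_Holder_on_imp_continuous_on:
  assumes \<alpha>: "\<alpha> > 0" and f: "locally_Holder_on \<alpha> U f"
  shows "continuous_on U f"
  unfolding continuous_on_def
proof
  fix x assume x: "x \<in> U"
  obtain e C where e: "e > 0"
    and C: "\<And>y z. y \<in> U \<inter> ball x e \<Longrightarrow> z \<in> U \<inter> ball x e \<Longrightarrow> dist (f y) (f z) \<le> C * dist y z powr \<alpha>"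
    using locally_Holder_onE[OF f x] by metis
  have "((\<lambda>y. dist y x) \<longlongrightarrow> 0) (at x within U)"
    using tendsto_dist[OF tendsto_ident_at[of x U] tendsto_const[of x]] by simp
  then have "((\<lambda>y. C * dist y x powr \<alpha>) \<longlongrightarrow> 0) (at x within U)"
    using \<alpha> by (intro tendsto_mult_right_zero tendsto_zero_powrI[OF _ tendsto_const]) auto
  moreover have "\<forall>\<^sub>F y in at x within U. norm (dist (f y) (f x)) \<le> C * dist y x powr \<alpha>"
    unfolding eventually_at using e x C by (intro exI[of _ e]) (auto simp: dist_commute)
  ultimately have "((\<lambda>y. dist (f y) (f x)) \<longlongrightarrow> 0) (at x within U)"
    by (rule Lim_null_comparison[rotated])
  then show "(f \<longlongrightarrow> f x) (at x within U)"
    by (subst tendsto_dist_iff)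
qed

text \<open>A ball about 0 is invariant under division by L, so \<open>holder_solution\<close>
  applies there; the local property then passes from x / L to x through the equation.\<close>

lemma locally_Holder_on_solution:
  fixes f g :: "real \<Rightarrow> real"
  assumes lam: "0 < lam" "lam < 1" and L: "L > 1" and \<alpha>: "\<alpha> \<ge> 0"
    and eq: "\<And>x. f x = lam * f (x / L) + g (x / L)"
    and f: "continuous_on UNIV f" and g: "locally_Holder_on \<alpha> UNIV g"
  shows "locally_Holder_on \<alpha> UNIV f"
proof -
  define Q where "Q x \<longleftrightarrow> (\<exists>e>0. \<exists>C. \<forall>y\<in>ball x e. \<forall>z\<in>ball x e. dist (f y) (f z) \<le> C * dist y z powr \<alpha>)" for x
  obtain e C where e: "e > 0" "C \<ge> 0"
    and C: "\<And>y z. y \<in> ball 0 e \<Longrightarrow> z \<in> ball 0 e \<Longrightarrow> dist (g y) (g z) \<le> C * dist y z powr \<alpha>"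
    using locally_Holder_onE[OF g UNIV_I, of 0] by auto
  have "compact (f ` cball 0 e)"
    using f by (intro compact_continuous_image) (auto intro: continuous_on_subset)
  then obtain M where M: "\<And>x. x \<in> cball 0 e \<Longrightarrow> \<bar>f x\<bar> \<le> M"
    using compact_imp_bounded by (force simp: bounded_iff)
  have shrink: "\<bar>x / L\<bar> \<le> \<bar>x\<bar>" for x
    using L by (simp only: abs_divide_le_self)
  have hold: "\<bar>f y - f z\<bar> \<le> C / (1 - lam) * \<bar>y - z\<bar> powr \<alpha>" if "y \<in> ball 0 e" "z \<in> ball 0 e" for y z
  proof (rule holder_solution[where S = "ball 0 e" and M = M and f = f and g = g, OF lam L \<alpha> e(2) eq])
    show "x / L \<in> ball 0 e" if "x \<in> ball 0 e" for x
      using that shrink[of x] by (simp add: dist_real_def)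
    show "\<bar>f x\<bar> \<le> M" if "x \<in> ball 0 e" for x
      using that by (intro M) simp
    show "\<bar>g x - g y\<bar> \<le> C * \<bar>x - y\<bar> powr \<alpha>" if "x \<in> ball 0 e" "y \<in> ball 0 e" for x y
      using C[OF that] by (simp add: dist_real_def)
  qed (use that in auto)
  have "Q x" for x
  proof (rule scaling_induct[where L = L and e = e and Q = Q])
    fix x :: real assume x: "\<bar>x\<bar> < e"
    have "y \<in> ball 0 e" if "y \<in> ball x (e - \<bar>x\<bar>)" for y
      using that by (simp add: dist_real_def)
    then have "\<forall>y\<in>ball x (e - \<bar>x\<bar>). \<forall>z\<in>ball x (e - \<bar>x\<bar>). dist (f y) (f z) \<le> C / (1 - lam) * dist y z powr \<alpha>"
      using hold by (simp add: dist_real_def)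
    with x show "Q x"
      unfolding Q_def by (intro exI[of _ "e - \<bar>x\<bar>"] conjI exI[of _ "C / (1 - lam)"]) simp_all
  next
    fix x assume "Q (x / L)"
    then obtain e1 C1 where 1: "e1 > 0"
      "\<And>y z. y \<in> ball (x / L) e1 \<Longrightarrow> z \<in> ball (x / L) e1 \<Longrightarrow> dist (f y) (f z) \<le> C1 * dist y z powr \<alpha>"
      unfolding Q_def by meson
    obtain e2 C2 where 2: "e2 > 0"
      "\<And>y z. y \<in> ball (x / L) e2 \<Longrightarrow> z \<in> ball (x / L) e2 \<Longrightarrow> dist (g y) (g z) \<le> C2 * dist y z powr \<alpha>"
      using locally_Holder_onE[OF g UNIV_I, of "x / L"] unfolding Int_UNIV_left by metis
    \<comment> \<open>Distances scale by 1 / L, which puts L powr \<alpha> into the denominator. The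
      constant may depend on x, since only local bounds are wanted.\<close>
    have "dist (f y) (f z) \<le> ((lam * C1 + C2) / L powr \<alpha>) * dist y z powr \<alpha>"
      if "y \<in> ball x (min e1 e2)" "z \<in> ball x (min e1 e2)" for y z
    proof -
      have "w / L \<in> ball (x / L) (min e1 e2)" if "w \<in> ball x (min e1 e2)" for w
        using that shrink[of "x - w"] by (simp add: dist_real_def diff_divide_distrib)
      with that have yz: "y / L \<in> ball (x / L) (min e1 e2)" "z / L \<in> ball (x / L) (min e1 e2)"
        by blast+
      have d: "dist (y / L) (z / L) powr \<alpha> = dist y z powr \<alpha> / L powr \<alpha>"
      proof -
        have "dist (y / L) (z / L) = dist y z / L"
          using L by (simp add: dist_real_def flip: diff_divide_distrib)
        then show ?thesis using L by (simp add: powr_divide)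
      qed
      have "f y - f z = lam * (f (y / L) - f (z / L)) + (g (y / L) - g (z / L))"
        using eq[of y] eq[of z] by (simp add: algebra_simps)
      then have "\<bar>f y - f z\<bar> \<le> lam * \<bar>f (y / L) - f (z / L)\<bar> + \<bar>g (y / L) - g (z / L)\<bar>"
        using abs_triangle_ineq lam by (metis abs_mult abs_of_pos)
      also have "\<dots> \<le> lam * (C1 * dist (y / L) (z / L) powr \<alpha>) + C2 * dist (y / L) (z / L) powr \<alpha>"
        using 1(2)[of "y / L" "z / L"] 2(2)[of "y / L" "z / L"] yz lam
        by (intro add_mono mult_left_mono) (auto simp: dist_real_def)
      also have "\<dots> = ((lam * C1 + C2) / L powr \<alpha>) * dist y z powr \<alpha>"
        unfolding d by (simp add: algebra_simps add_divide_distrib)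
      finally show ?thesis by (simp add: dist_real_def)
    qed
    then show "Q x"
      unfolding Q_def using 1(1) 2(1)
      by (intro exI[of _ "min e1 e2"] conjI exI[of _ "(lam * C1 + C2) / L powr \<alpha>"]) auto
  qed (use L e in auto)
  then show ?thesis
    by (simp add: Q_def locally_Holder_on_def)
qed

section \<open>Derivatives of solutions and the classes C^r on the line\<close>

lemma DERIV_frechet_derivative:
  fixes f :: "real \<Rightarrow> real"
  assumes "f differentiable at x"
  shows "DERIV f x :> frechet_derivative f (at x) 1"
    and "frechet_derivative f (at x) v = v * frechet_derivative f (at x) 1"
proof -
  have "(f has_derivative frechet_derivative f (at x)) (at x)"
    using assms by (simp add: frechet_derivative_works)
  then interpret bounded_linear "frechet_derivative f (at x)"
    by (rule has_derivative_bounded_linear)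
  show lin: "frechet_derivative f (at x) v = v * frechet_derivative f (at x) 1" for v
    using scaleR[of v 1] by simp
  have "frechet_derivative f (at x) = (*) (frechet_derivative f (at x) 1)"
    by (rule ext) (metis lin mult.commute)
  then show "DERIV f x :> frechet_derivative f (at x) 1"
    using \<open>(f has_derivative _) _\<close> by (metis has_field_derivative_def)
qed

text \<open>Iterating the equation n times leaves the remainder lam ^ n * f (x / L ^ n), which tends
  to 0 because f (x / L ^ n) tends to f 0.\<close>

lemma solution_sums:
  fixes f g :: "real \<Rightarrow> real"
  assumes lam: "0 < lam" "lam < 1" and L: "L > 1"
    and eq: "\<And>x. f x = lam * f (x / L) + g (x / L)" and f: "continuous_on UNIV f"
  shows "(\<lambda>n. lam ^ n * g (x / L ^ Suc n)) sums f x"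
proof -
  have part: "(\<Sum>i<n. lam ^ i * g (x / L ^ Suc i)) = f x - lam ^ n * f (x / L ^ n)" for n
  proof (induction n)
    case (Suc n)
    then show ?case
      using eq[of "x / L ^ n"] by (simp add: algebra_simps)
  qed simp
  have "(\<lambda>n. f (x / L ^ n)) \<longlonglongrightarrow> f 0"
    using f LIMSEQ_divide_realpow_zero[OF L, of x] continuous_on_eq_continuous_at
      isCont_tendsto_compose by blast
  moreover have "(\<lambda>n. lam ^ n) \<longlonglongrightarrow> 0"
    using lam by (intro LIMSEQ_power_zero) auto
  ultimately have "(\<lambda>n. f x - lam ^ n * f (x / L ^ n)) \<longlonglongrightarrow> f x - 0 * f 0"
    by (intro tendsto_diff tendsto_mult tendsto_const)
  then show ?thesis
    unfolding sums_def part by simp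
qed

text \<open>The series from \<open>solution_sums\<close> can be differentiated term by term: on
  bounded sets the derived terms are dominated by a geometric series.\<close>

lemma differentiable_solution:
  fixes f g :: "real \<Rightarrow> real"
  assumes lam: "0 < lam" "lam < 1" and L: "L > 1"
    and eq: "\<And>x. f x = lam * f (x / L) + g (x / L)" and f: "continuous_on UNIV f"
    and g: "\<And>x. DERIV g x :> g' x" and g': "continuous_on UNIV g'"
  obtains f' where "\<And>x. DERIV f x :> f' x" "continuous_on UNIV f'"
    "\<And>x. f' x = lam / L * f' (x / L) + g' (x / L) / L"
proof -
  define u where "u n x = lam ^ n * g (x / L ^ Suc n)" for n x
  define u' where "u' n x = lam ^ n * (g' (x / L ^ Suc n) / L ^ Suc n)" for n x
  define f' where "f' x = (\<Sum>n. u' n x)" for x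
  have u: "(u n has_field_derivative u' n x) (at x)" for n x
  proof -
    have "((\<lambda>x. g (x / L ^ Suc n)) has_field_derivative g' (x / L ^ Suc n) * (1 / L ^ Suc n)) (at x)"
      by (rule DERIV_chain2[OF g]) (use L in \<open>auto intro!: derivative_eq_intros\<close>)
    then show ?thesis
      unfolding u_def[abs_def] u'_def by (auto intro!: derivative_eq_intros)
  qed
  have main: "DERIV f x :> f' x \<and> isCont f' x" for x
  proof -
    \<comment> \<open>The ball is centred at 0 rather than at x: it contains y / L ^ Suc n along
      with y, so one bound B on g' serves all terms.\<close>
    define R where "R = \<bar>x\<bar> + 1"
    have "compact (g' ` cball 0 R)"
      using g' by (intro compact_continuous_image) (auto intro: continuous_on_subset)
    then obtain B where B: "\<And>y. y \<in> cball 0 R \<Longrightarrow> \<bar>g' y\<bar> \<le> B"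
      using compact_imp_bounded by (force simp: bounded_iff)
    let ?S = "ball 0 R :: real set"
    have x: "x \<in> ?S" by (simp add: R_def)
    have "uniform_limit ?S (\<lambda>n x. \<Sum>i<n. u' i x) f' sequentially"
      unfolding f'_def
    proof (rule Weierstrass_m_test)
      show "summable (\<lambda>n. lam ^ n * B)"
        using lam by (intro summable_mult2 summable_geometric) auto
      fix n y assume y: "y \<in> ?S"
      have L1: "L ^ Suc n \<ge> 1" using L by (intro one_le_power) auto
      have "\<bar>y / L ^ Suc n\<bar> \<le> \<bar>y\<bar>"
        using L1 by (rule abs_divide_le_self)
      with y have "\<bar>g' (y / L ^ Suc n)\<bar> \<le> B"
        by (intro B) (simp add: dist_real_def del: power_Suc)
      moreover have "\<bar>g' (y / L ^ Suc n) / L ^ Suc n\<bar> \<le> \<bar>g' (y / L ^ Suc n)\<bar>"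
        using L1 by (rule abs_divide_le_self)
      ultimately have "\<bar>g' (y / L ^ Suc n) / L ^ Suc n\<bar> \<le> B" by linarith
      then have "lam ^ n * \<bar>g' (y / L ^ Suc n) / L ^ Suc n\<bar> \<le> lam ^ n * B"
        using lam by (intro mult_left_mono) auto
      then show "norm (u' n y) \<le> lam ^ n * B"
        unfolding u'_def real_norm_def abs_mult[of "lam ^ n"] using lam by simp
    qed
    note unif = this
    have "summable (\<lambda>n. u n x)"
      using solution_sums[OF lam L eq f, of x] unfolding u_def by (rule sums_summable)
    then obtain h where h: "\<And>y. y \<in> ?S \<Longrightarrow> (\<lambda>n. u n y) sums h y"
      "\<And>y. y \<in> ?S \<Longrightarrow> (h has_field_derivative f' y) (at y within ?S)"
      using has_field_derivative_series[OF convex_ball DERIV_subset[OF u] unif x] by blast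
    have "h y = f y" if "y \<in> ?S" for y
      using sums_unique2[OF h(1)[OF that]] solution_sums[OF lam L eq f, of y] by (simp add: u_def)
    moreover have "(h has_field_derivative f' x) (at x)"
      using h(2)[OF x] x by (simp add: at_within_open[OF x])
    ultimately have "DERIV f x :> f' x"
      using x by (rule_tac has_field_derivative_transform_within_open[of h _ _ ?S]) auto
    moreover have "continuous_on ?S (u' i)" for i
      unfolding u'_def using L by (intro continuous_intros continuous_on_compose2[OF g']) auto
    then have "continuous_on ?S f'"
      by (intro uniform_limit_theorem[OF _ unif]) (auto intro!: always_eventually continuous_intros)
    then have "isCont f' x"
      using x by (simp add: continuous_on_eq_continuous_at)
    ultimately show ?thesis by blast
  qed
  \<comment> \<open>Both sides are derivatives of f at x, the right one by differentiating the
    equation.\<close>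
  have "f' x = lam / L * f' (x / L) + g' (x / L) / L" for x
  proof (rule DERIV_unique)
    show "DERIV f x :> f' x" using main by blast
    have "((\<lambda>x. lam * f (x / L) + g (x / L)) has_field_derivative
        lam * (f' (x / L) * (1 / L)) + g' (x / L) * (1 / L)) (at x)"
      using L by (intro DERIV_add DERIV_cmult DERIV_chain2[OF g] DERIV_chain2[OF conjunct1[OF main]])
        (auto intro!: derivative_eq_intros)
    moreover have "(\<lambda>x. lam * f (x / L) + g (x / L)) = f"
      by (rule ext) (rule eq[symmetric])
    ultimately show "DERIV f x :> lam / L * f' (x / L) + g' (x / L) / L"
      by simp
  qed
  with main show ?thesis
    by (intro that[of f'] continuous_at_imp_continuous_on) blast+
qed

lemma iterated_diff_on_imp_continuous_on:
  assumes "\<And>f. P f \<Longrightarrow> continuous_on U f" and "iterated_diff_on P k U f"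
  shows "continuous_on U f"
  using assms by (cases k)
    (auto intro!: continuous_at_imp_continuous_on differentiable_imp_continuous_within)

text \<open>\<open>P\<close> is abstract so that one induction covers continuous and locally Hoelder
  top derivatives. The factor lam has to vary in the induction, because the derivative solves the
  equation with lam / L.\<close>

lemma iterated_diff_on_solution:
  fixes f g :: "real \<Rightarrow> real"
  assumes L: "L > 1" and P_cont: "\<And>f. P f \<Longrightarrow> continuous_on UNIV f"
    and P_sol: "\<And>lam f g. 0 < lam \<Longrightarrow> lam < 1 \<Longrightarrow> (\<And>x. f x = lam * f (x / L) + g (x / L)) \<Longrightarrow>
      continuous_on UNIV f \<Longrightarrow> P g \<Longrightarrow> P f"
    and lam: "0 < lam" "lam < 1" and eq: "\<And>x. f x = lam * f (x / L) + g (x / L)"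
    and f: "continuous_on UNIV f" and g: "iterated_diff_on P k UNIV g"
  shows "iterated_diff_on P k UNIV f"
  using lam eq f g
proof (induction k arbitrary: lam f g)
  case 0
  show ?case
    unfolding iterated_diff_on.simps by (rule P_sol[OF 0(1-4)]) (use 0(5) in simp)
next
  case (Suc k)
  have diff: "g differentiable at x"
    and it: "iterated_diff_on P k UNIV (\<lambda>x. frechet_derivative g (at x) v)" for x v
    using Suc.prems(5) by auto
  obtain f' where f': "\<And>x. DERIV f x :> f' x" "continuous_on UNIV f'"
    "\<And>x. f' x = lam / L * f' (x / L) + frechet_derivative g (at (x / L)) 1 / L"
    using differentiable_solution[OF Suc.prems(1,2) L Suc.prems(3,4) DERIV_frechet_derivative(1)[OF diff]
        iterated_diff_on_imp_continuous_on[OF P_cont it]] by metis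
  have frechet: "frechet_derivative f (at x) v = v * f' x" for x v
    using frechet_derivative_at[OF f'(1)[unfolded has_field_derivative_def]] by (metis mult.commute)
  have "iterated_diff_on P k UNIV (\<lambda>x. v * f' x)" for v
  \<comment> \<open>The factor 1 / L produced by the chain rule is absorbed into the direction v / L
    of the derivative of g.\<close>
  proof (rule Suc.IH[of "lam / L" "\<lambda>x. v * f' x" "\<lambda>x. frechet_derivative g (at x) (v / L)"])
    show "0 < lam / L" "lam / L < 1"
      using Suc.prems(1,2) L by (simp_all add: field_simps)
    show "continuous_on UNIV (\<lambda>x. v * f' x)"
      by (intro continuous_intros f'(2))
    show "v * f' x = lam / L * (v * f' (x / L)) + frechet_derivative g (at (x / L)) (v / L)" for x
      using f'(3)[of x] DERIV_frechet_derivative(2)[OF diff, of "x / L" "v / L"]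
      by (simp add: algebra_simps)
  qed (rule it)
  moreover have "f differentiable at x" for x
    using f'(1) real_differentiable_def by blast
  ultimately show ?case by (simp add: frechet)
qed

lemma C_real_on_solution:
  fixes f g :: "real \<Rightarrow> real"
  assumes lam: "0 < lam" "lam < 1" and L: "L > 1"
    and eq: "\<And>x. f x = lam * f (x / L) + g (x / L)" and f: "continuous_on UNIV f"
    and g: "C_real_on r UNIV g"
  shows "C_real_on r UNIV f"
proof (cases "frac r = 0")
  case True
  have "iterated_diff_on (continuous_on UNIV) (nat \<lfloor>r\<rfloor>) UNIV f"
  proof (rule iterated_diff_on_solution[OF L _ _ lam eq f])
    show "iterated_diff_on (continuous_on UNIV) (nat \<lfloor>r\<rfloor>) UNIV g"
      using g True by (simp add: C_real_on_def)
  qed assumption+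
  with True show ?thesis by (simp add: C_real_on_def)
next
  case False
  then have \<alpha>: "frac r > 0"
    by (simp add: frac_gt_0_iff)
  have "iterated_diff_on (locally_Holder_on (frac r) UNIV) (nat \<lfloor>r\<rfloor>) UNIV f"
  proof (rule iterated_diff_on_solution[OF L _ _ lam eq f])
    show "iterated_diff_on (locally_Holder_on (frac r) UNIV) (nat \<lfloor>r\<rfloor>) UNIV g"
      using g False by (simp add: C_real_on_def)
  qed (fact locally_Holder_on_imp_continuous_on[OF \<alpha>]
      locally_Holder_on_solution[OF _ _ L less_imp_le[OF \<alpha>]])+
  with False show ?thesis by (simp add: C_real_on_def)
qed

lemma C_ext_on_solution:
  fixes f g :: "real \<Rightarrow> real"
  assumes "0 < lam" "lam < 1" "L > 1" "\<And>x. f x = lam * f (x / L) + g (x / L)"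
    and "continuous_on UNIV f" "C_ext_on r UNIV g"
  shows "C_ext_on r UNIV f"
  using assms(6) C_real_on_solution[OF assms(1-5)] by (auto simp: C_ext_on_def split: if_splits)

section \<open>Continuity of C^r functions, and affine maps perturbed by a function of one linear
  form\<close>

lemma C_real_on_imp_continuous_on:
  assumes "C_real_on r U f"
  shows "continuous_on U f"
proof (cases "frac r = 0")
  case True
  then show ?thesis
    using assms iterated_diff_on_imp_continuous_on[of "continuous_on U"] by (auto simp: C_real_on_def)
next
  case False
  then have \<alpha>: "frac r > 0"
    by (simp add: frac_gt_0_iff)
  have "iterated_diff_on (locally_Holder_on (frac r) U) (nat \<lfloor>r\<rfloor>) U f"
    using assms False by (simp add: C_real_on_def)
  then show ?thesis
    by (rule iterated_diff_on_imp_continuous_on[rotated]) (rule locally_Holder_on_imp_continuous_on[OF \<alpha>])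
qed

lemma C_ext_on_imp_continuous_on:
  "C_ext_on r U f \<Longrightarrow> continuous_on U f"
  by (auto simp: C_ext_on_def intro: C_real_on_imp_continuous_on split: if_splits)

text \<open>The conjugacy in charts is an affine map plus a ridge function, and this shape survives
  directional differentiation, which makes induction on k possible.\<close>

lemma iterated_diff_on_ridge:
  fixes f :: "real \<Rightarrow> real" and \<phi> :: "'a::euclidean_space \<Rightarrow> real" and B :: "'a \<Rightarrow> 'b::euclidean_space"
  assumes base: "\<And>f w B. P f \<Longrightarrow> bounded_linear B \<Longrightarrow> P' (\<lambda>p. w + B p + f (\<phi> p) *\<^sub>R u)"
    and \<phi>: "bounded_linear \<phi>" and B: "bounded_linear B" and f: "iterated_diff_on P k UNIV f"
  shows "iterated_diff_on P' k UNIV (\<lambda>p. w + B p + f (\<phi> p) *\<^sub>R u)"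
  using B f
proof (induction k arbitrary: w B f)
  case 0
  then show ?case using base by simp
next
  case (Suc k)
  have "((\<lambda>p. w + B p + f (\<phi> p) *\<^sub>R u) has_derivative
      (\<lambda>v. B v + 0 + frechet_derivative f (at (\<phi> p)) (\<phi> v) *\<^sub>R u)) (at p)" for p
  proof -
    have "((\<lambda>p. f (\<phi> p)) has_derivative (\<lambda>v. frechet_derivative f (at (\<phi> p)) (\<phi> v))) (at p)"
      using Suc.prems(2) frechet_derivative_works
      by (intro has_derivative_compose[OF bounded_linear_imp_has_derivative[OF \<phi>]]) auto
    then show ?thesis
      by (auto intro!: derivative_eq_intros bounded_linear_imp_has_derivative Suc.prems(1))
  qed
  note der = this
  have "frechet_derivative (\<lambda>p. w + B p + f (\<phi> p) *\<^sub>R u) (at p) v =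
      B v + 0 + frechet_derivative f (at (\<phi> p)) (\<phi> v) *\<^sub>R u" for p v
    using fun_cong[OF frechet_derivative_at[OF der]] by metis
  \<comment> \<open>The linear part differentiates to a constant, so the induction hypothesis is
    used with \<open>B v\<close> as constant term and 0 as linear part.\<close>
  moreover have "iterated_diff_on P' k UNIV (\<lambda>p. B v + 0 + frechet_derivative f (at (\<phi> p)) (\<phi> v) *\<^sub>R u)" for v
    using Suc.prems(2) by (intro Suc.IH[where B = "\<lambda>_. 0"]) auto
  moreover have "(\<lambda>p. w + B p + f (\<phi> p) *\<^sub>R u) differentiable (at p)" for p
    using der by (rule differentiableI)
  ultimately show ?case by simp
qed

text \<open>A bounded linear map is Lipschitz, hence \<alpha>-Hoelder on sets of diameter at most 1,
  because \<alpha> \<le> 1.\<close>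

lemma locally_Holder_on_ridge:
  fixes f :: "real \<Rightarrow> real" and \<phi> :: "'a::euclidean_space \<Rightarrow> real" and B :: "'a \<Rightarrow> 'b::euclidean_space"
  assumes \<alpha>: "0 < \<alpha>" "\<alpha> \<le> 1" and \<phi>: "bounded_linear \<phi>" and B: "bounded_linear B"
    and f: "locally_Holder_on \<alpha> UNIV f"
  shows "locally_Holder_on \<alpha> UNIV (\<lambda>p. w + B p + f (\<phi> p) *\<^sub>R u)"
  unfolding locally_Holder_on_def
proof
  fix p :: 'a
  obtain e C where e: "e > 0" "C \<ge> 0"
    and C: "\<And>y z. y \<in> ball (\<phi> p) e \<Longrightarrow> z \<in> ball (\<phi> p) e \<Longrightarrow> dist (f y) (f z) \<le> C * dist y z powr \<alpha>"
    using locally_Holder_onE[OF f UNIV_I, of "\<phi> p"] by auto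
  obtain K where K: "K > 0" "\<And>v. \<bar>\<phi> v\<bar> \<le> K * norm v"
    using bounded_linear.pos_bounded[OF \<phi>] by (auto simp: mult.commute)
  obtain K' where K': "K' > 0" "\<And>v. norm (B v) \<le> K' * norm v"
    using bounded_linear.pos_bounded[OF B] by (auto simp: mult.commute)
  have \<phi>_dist: "dist (\<phi> y) (\<phi> z) \<le> K * dist y z" for y z
    using K(2)[of "y - z"] bounded_linear.linear[OF \<phi>] by (simp add: dist_norm linear_diff)
  have B_dist: "dist (B y) (B z) \<le> K' * dist y z" for y z
    using K'(2)[of "y - z"] bounded_linear.linear[OF B] by (simp add: dist_norm linear_diff)
  \<comment> \<open>The bound e / K keeps the images under \<phi> in the ball where f is controlled;
    1 / 2 keeps mutual distances at most 1.\<close>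
  define r where "r = min (e / K) (1 / 2)"
  have "dist (w + B y + f (\<phi> y) *\<^sub>R u) (w + B z + f (\<phi> z) *\<^sub>R u) \<le> (K' + C * K powr \<alpha> * norm u) * dist y z powr \<alpha>"
    if yz: "y \<in> ball p r" "z \<in> ball p r" for y z
  proof -
    have mem: "\<phi> x \<in> ball (\<phi> p) e" if "x \<in> ball p r" for x
    proof -
      have "dist p x < e / K" using that by (simp add: r_def)
      then have "K * dist p x < e" using K by (simp add: field_simps)
      then show ?thesis using \<phi>_dist[of p x] by simp
    qed
    have "dist y z \<le> 1"
      using dist_triangle2[of y z p] yz by (simp add: r_def dist_commute)
    then have d: "dist y z \<le> dist y z powr \<alpha>"
      using \<alpha> powr_mono'[of \<alpha> 1 "dist y z"] by simp
    have "dist (w + B y + f (\<phi> y) *\<^sub>R u) (w + B z + f (\<phi> z) *\<^sub>R u) =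
        norm ((B y - B z) + (f (\<phi> y) - f (\<phi> z)) *\<^sub>R u)"
      by (simp add: dist_norm algebra_simps)
    also have "\<dots> \<le> dist (B y) (B z) + dist (f (\<phi> y)) (f (\<phi> z)) * norm u"
      using norm_triangle_ineq by (metis dist_norm norm_scaleR real_norm_def)
    also have "\<dots> \<le> K' * dist y z powr \<alpha> + C * (K powr \<alpha> * dist y z powr \<alpha>) * norm u"
    proof (intro add_mono mult_right_mono)
      show "dist (B y) (B z) \<le> K' * dist y z powr \<alpha>"
        using B_dist[of y z] d K' by (meson less_imp_le mult_left_mono order_trans)
      have "dist (\<phi> y) (\<phi> z) powr \<alpha> \<le> (K * dist y z) powr \<alpha>"
        using \<phi>_dist \<alpha> by (intro powr_mono2) auto
      also have "\<dots> = K powr \<alpha> * dist y z powr \<alpha>"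
        using K by (simp add: powr_mult)
      finally show "dist (f (\<phi> y)) (f (\<phi> z)) \<le> C * (K powr \<alpha> * dist y z powr \<alpha>)"
        using C[OF mem[OF yz(1)] mem[OF yz(2)]] e(2) by (meson mult_left_mono order_trans)
    qed simp
    finally show ?thesis by (simp add: algebra_simps)
  qed
  moreover have "r > 0" using e K by (simp add: r_def)
  ultimately show "\<exists>e>0. \<exists>C. \<forall>y\<in>UNIV \<inter> ball p e. \<forall>z\<in>UNIV \<inter> ball p e.
      dist (w + B y + f (\<phi> y) *\<^sub>R u) (w + B z + f (\<phi> z) *\<^sub>R u) \<le> C * dist y z powr \<alpha>"
    by (intro exI[of _ r] conjI exI[of _ "K' + C * K powr \<alpha> * norm u"]) auto
qed

lemma C_real_on_ridge:
  fixes f :: "real \<Rightarrow> real" and \<phi> :: "'a::euclidean_space \<Rightarrow> real" and B :: "'a \<Rightarrow> 'b::euclidean_space"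
  assumes \<phi>: "bounded_linear \<phi>" and B: "bounded_linear B" and f: "C_real_on r UNIV f"
  shows "C_real_on r UNIV (\<lambda>p. w + B p + f (\<phi> p) *\<^sub>R u)"
proof (cases "frac r = 0")
  case True
  have "continuous_on UNIV (\<lambda>p. w + B p + f (\<phi> p) *\<^sub>R u)"
    if "continuous_on UNIV f" "bounded_linear B" for f w and B :: "'a \<Rightarrow> 'b"
    using that \<phi>
    by (intro continuous_intros continuous_on_compose2[OF that(1)] linear_continuous_on) auto
  then show ?thesis
    using f True unfolding C_real_on_def by (auto intro!: iterated_diff_on_ridge[OF _ \<phi> B])
next
  case False
  then have \<alpha>: "0 < frac r" "frac r \<le> 1"
    using frac_lt_1[of r] by (simp_all add: frac_gt_0_iff)
  have "iterated_diff_on (locally_Holder_on (frac r) UNIV) (nat \<lfloor>r\<rfloor>) UNIV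
      (\<lambda>p. w + B p + f (\<phi> p) *\<^sub>R u)"
  proof (rule iterated_diff_on_ridge[OF _ \<phi> B])
    show "iterated_diff_on (locally_Holder_on (frac r) UNIV) (nat \<lfloor>r\<rfloor>) UNIV f"
      using f False by (simp add: C_real_on_def)
    show "locally_Holder_on (frac r) UNIV (\<lambda>p. w + B p + f (\<phi> p) *\<^sub>R u)"
      if "locally_Holder_on (frac r) UNIV f" "bounded_linear B" for f w and B :: "'a \<Rightarrow> 'b"
      by (rule locally_Holder_on_ridge[OF \<alpha> \<phi> that(2,1)])
  qed
  with False show ?thesis by (simp add: C_real_on_def)
qed

lemma C_ext_on_ridge:
  fixes f :: "real \<Rightarrow> real" and \<phi> :: "'a::euclidean_space \<Rightarrow> real" and B :: "'a \<Rightarrow> 'b::euclidean_space"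
  assumes "bounded_linear \<phi>" "bounded_linear B" "C_ext_on r UNIV f"
  shows "C_ext_on r UNIV (\<lambda>p. w + B p + f (\<phi> p) *\<^sub>R u)"
  using assms by (auto simp: C_ext_on_def intro: C_real_on_ridge split: if_splits)

section \<open>Real analytic functions\<close>

definition power_series_at :: "(real \<Rightarrow> real) \<Rightarrow> real \<Rightarrow> bool" where
  "power_series_at f x \<longleftrightarrow> (\<exists>e>0. \<exists>a. \<forall>y. \<bar>y - x\<bar> < e \<longrightarrow> (\<lambda>n. a n * (y - x) ^ n) sums f y)"

lemma power_series_atI:
  assumes "e > 0" "\<And>y. \<bar>y - x\<bar> < e \<Longrightarrow> (\<lambda>n. a n * (y - x) ^ n) sums f y"
  shows "power_series_at f x"
  using assms unfolding power_series_at_def by blast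

text \<open>Convergence at a real point x + w with norm z < w < e forces absolute convergence at z,
  even for complex z.\<close>

lemma power_series_summable_norm:
  fixes a :: "nat \<Rightarrow> real" and z :: "'a::{real_normed_div_algebra, banach}"
  assumes sums: "\<And>y. \<bar>y - x\<bar> < e \<Longrightarrow> (\<lambda>n. a n * (y - x) ^ n) sums f y" and z: "norm z < e"
  shows "summable (\<lambda>n. norm (of_real (a n) * z ^ n))"
proof -
  obtain w where w: "norm z < w" "w < e"
    using dense[OF z] by blast
  then have w0: "w > 0" by (meson norm_ge_zero le_less_trans)
  have "summable (\<lambda>n. a n * w ^ n)"
    using sums_summable[OF sums[of "x + w"]] w w0 by simp
  then have "summable (\<lambda>n. norm (a n * norm z ^ n))"
    by (rule powser_insidea) (use w w0 in auto)
  then show ?thesis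
    by (simp add: norm_mult norm_power abs_mult)
qed

lemma power_series_at_add:
  assumes "power_series_at f x" "power_series_at g x"
  shows "power_series_at (\<lambda>y. f y + g y) x"
proof -
  obtain e1 a where 1: "e1 > 0" "\<And>y. \<bar>y - x\<bar> < e1 \<Longrightarrow> (\<lambda>n. a n * (y - x) ^ n) sums f y"
    using assms(1) unfolding power_series_at_def by blast
  obtain e2 b where 2: "e2 > 0" "\<And>y. \<bar>y - x\<bar> < e2 \<Longrightarrow> (\<lambda>n. b n * (y - x) ^ n) sums g y"
    using assms(2) unfolding power_series_at_def by blast
  show ?thesis
  proof (rule power_series_atI[where e = "min e1 e2" and a = "\<lambda>n. a n + b n"])
    fix y assume "\<bar>y - x\<bar> < min e1 e2"
    then show "(\<lambda>n. (a n + b n) * (y - x) ^ n) sums (f y + g y)"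
      using sums_add[OF 1(2) 2(2)] by (simp add: algebra_simps)
  qed (use 1 2 in auto)
qed

lemma power_series_at_scale:
  assumes "power_series_at f (x / L)" and L: "L > 0"
  shows "power_series_at (\<lambda>y. c * f (y / L)) x"
proof -
  obtain e a where e: "e > 0" "\<And>y. \<bar>y - x / L\<bar> < e \<Longrightarrow> (\<lambda>n. a n * (y - x / L) ^ n) sums f y"
    using assms(1) unfolding power_series_at_def by blast
  show ?thesis
  proof (rule power_series_atI[where e = "L * e" and a = "\<lambda>n. c * (a n / L ^ n)"])
    fix y assume y: "\<bar>y - x\<bar> < L * e"
    have d: "y / L - x / L = (y - x) / L" by (simp add: diff_divide_distrib)
    have "\<bar>y / L - x / L\<bar> < e"
      unfolding d using y L by (simp add: field_simps)
    then have "(\<lambda>n. c * (a n * ((y - x) / L) ^ n)) sums (c * f (y / L))"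
      using e(2)[of "y / L"] unfolding d by (intro sums_mult)
    then show "(\<lambda>n. c * (a n / L ^ n) * (y - x) ^ n) sums (c * f (y / L))"
      by (simp add: power_divide mult.assoc)
  qed (use L e in auto)
qed

lemma power_series_at_isCont:
  assumes "power_series_at f x"
  shows "isCont f x"
proof -
  obtain e a where e: "e > 0" and a: "\<And>y. \<bar>y - x\<bar> < e \<Longrightarrow> (\<lambda>n. a n * (y - x) ^ n) sums f y"
    using assms unfolding power_series_at_def by blast
  have "summable (\<lambda>n. a n * (e / 2) ^ n)"
    using sums_summable[OF a[of "x + e / 2"]] e by simp
  then have "isCont (\<lambda>z. \<Sum>n. a n * z ^ n) (x - x)"
    by (rule isCont_powser) (use e in auto)
  then have "isCont (\<lambda>y. \<Sum>n. a n * (y - x) ^ n) x"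
    by (intro isCont_o2[where g = "\<lambda>z. \<Sum>n. a n * z ^ n" and f = "\<lambda>y. y - x"] continuous_intros)
  moreover have "\<forall>\<^sub>F y in nhds x. f y = (\<Sum>n. a n * (y - x) ^ n)"
    unfolding eventually_nhds_metric using e a
    by (intro exI[of _ e]) (auto simp: dist_real_def sums_iff)
  ultimately show ?thesis
    by (simp add: isCont_cong)
qed

text \<open>Recentring passes through the holomorphic extension of the series to a complex disc.\<close>

lemma power_series_at_nearby:
  assumes "power_series_at f x"
  obtains e where "e > 0" "\<And>y. \<bar>y - x\<bar> < e \<Longrightarrow> power_series_at f y"
proof -
  obtain e a where e: "e > 0" and a: "\<And>y. \<bar>y - x\<bar> < e \<Longrightarrow> (\<lambda>n. a n * (y - x) ^ n) sums f y"
    using assms unfolding power_series_at_def by blast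
  define h :: "complex \<Rightarrow> complex" where "h z = (\<Sum>n. of_real (a n) * (z - of_real x) ^ n)" for z
  have h: "(\<lambda>n. of_real (a n) * (z - of_real x) ^ n) sums h z" if "z \<in> ball (of_real x) e" for z
  proof -
    have "norm (z - of_real x) < e"
      using that by (simp add: dist_norm norm_minus_commute)
    from summable_norm_cancel[OF power_series_summable_norm[OF a this]] show ?thesis
      unfolding h_def by (rule summable_sums)
  qed
  have hol: "h holomorphic_on ball (of_real x) e"
    by (rule power_series_holomorphic[where a = "\<lambda>n. of_real (a n)"]) (rule h)
  have h_real: "h (of_real y) = of_real (f y)" if "\<bar>y - x\<bar> < e" for y
  proof (rule sums_unique2)
    have "dist (of_real x) (of_real y :: complex) < e"
      using that by (simp add: dist_of_real dist_real_def abs_minus_commute)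
    then show "(\<lambda>n. of_real (a n) * (of_real y - of_real x) ^ n) sums h (of_real y)"
      by (intro h) simp
    show "(\<lambda>n. of_real (a n) * (of_real y - of_real x) ^ n) sums (of_real (f y) :: complex)"
      using sums_of_real[OF a[OF that]] by simp
  qed
  have "power_series_at f y" if y: "\<bar>y - x\<bar> < e" for y
  proof (rule power_series_atI)
    show "e - \<bar>y - x\<bar> > 0" using y by simp
    fix w assume w: "\<bar>w - y\<bar> < e - \<bar>y - x\<bar>"
    define c where "c n = (deriv ^^ n) h (of_real y) / fact n" for n
    have "ball (of_real y) (e - \<bar>y - x\<bar>) \<subseteq> ball (of_real x :: complex) e"
      by (rule ball_subset_ball_iff[THEN iffD2]) (simp add: dist_of_real dist_real_def)
    with hol have "h holomorphic_on ball (of_real y) (e - \<bar>y - x\<bar>)"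
      by (rule holomorphic_on_subset)
    moreover have "of_real w \<in> ball (of_real y :: complex) (e - \<bar>y - x\<bar>)"
      using w by (simp add: dist_of_real dist_real_def abs_minus_commute)
    ultimately have "(\<lambda>n. c n * (of_real w - of_real y) ^ n) sums h (of_real w)"
      unfolding c_def by (rule holomorphic_power_series)
    \<comment> \<open>As w - y is real, taking real parts turns the complex expansion into a real
      power series with coefficients \<open>Re (c n)\<close>.\<close>
    then have "(\<lambda>n. Re (c n * (of_real w - of_real y) ^ n)) sums Re (h (of_real w))"
      by (rule sums_Re)
    moreover have "Re (c n * (of_real w - of_real y) ^ n) = Re (c n) * (w - y) ^ n" for n
    proof -
      have "(of_real w - of_real y :: complex) ^ n = of_real ((w - y) ^ n)" by simp
      then show ?thesis by (simp only: Re_complex_of_real Im_complex_of_real times_complex.simps)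
    qed
    moreover have "Re (h (of_real w)) = f w"
      using h_real[of w] w by simp
    ultimately show "(\<lambda>n. Re ((deriv ^^ n) h (of_real y) / fact n) * (w - y) ^ n) sums f w"
      by (simp add: c_def)
  qed
  with e show ?thesis by (rule that)
qed

text \<open>Comparing coefficients in the functional equation at the fixed point \<open>0\<close>.\<close>

lemma power_series_at_0_solution:
  fixes f g :: "real \<Rightarrow> real"
  assumes lam: "0 < lam" "lam < 1" and L: "L > 1"
    and eq: "\<And>x. f x = lam * f (x / L) + g (x / L)" and f: "isCont f 0"
    and g: "power_series_at g 0"
  shows "power_series_at f 0"
proof -
  obtain e a where e: "e > 0" and a: "\<And>y. \<bar>y - 0\<bar> < e \<Longrightarrow> (\<lambda>n. a n * (y - 0) ^ n) sums g y"
    using g unfolding power_series_at_def by blast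
  \<comment> \<open>Comparing coefficients of x ^ n in the equation gives b n * L ^ n = lam * b n +
    a n. The denominator is at least 1 - lam, so the new series converges wherever |x| < e.\<close>
  define b where "b n = a n / (L ^ n - lam)" for n
  have Ln: "L ^ n - lam \<ge> 1 - lam" for n
    using L one_le_power[of L n] by simp
  define B where "B x = (\<Sum>n. b n * x ^ n)" for x
  have B: "(\<lambda>n. b n * x ^ n) sums B x" if x: "\<bar>x\<bar> < e" for x
    unfolding B_def
  proof (rule summable_sums, rule summable_comparison_test)
    have "norm x < e"
      using x by (simp only: real_norm_def)
    from power_series_summable_norm[OF a this] have "summable (\<lambda>n. norm (of_real (a n) * x ^ n))" .
    then show "summable (\<lambda>n. norm (a n * x ^ n) / (1 - lam))"
      by (rule_tac summable_divide) (simp only: of_real_eq_id id_apply)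
    have "norm (b n * x ^ n) \<le> norm (a n * x ^ n) / (1 - lam)" for n
    proof -
      have "norm (b n * x ^ n) = norm (a n * x ^ n) / (L ^ n - lam)"
        using Ln[of n] lam by (simp add: b_def abs_mult)
      also have "\<dots> \<le> norm (a n * x ^ n) / (1 - lam)"
        using Ln[of n] lam by (intro divide_left_mono) auto
      finally show ?thesis .
    qed
    then show "\<exists>N. \<forall>n\<ge>N. norm (b n * x ^ n) \<le> norm (a n * x ^ n) / (1 - lam)" by blast
  qed
  have B_series: "power_series_at B 0"
    using B by (intro power_series_atI[OF e]) simp
  \<comment> \<open>\<open>D\<close> satisfies the homogeneous equation D x = lam * D (x / L) near
    0; iteration and continuity at 0 force it to vanish there.\<close>
  define D where "D x = f x - B x" for x
  have shrink: "\<bar>x / L\<bar> < e" if "\<bar>x\<bar> < e" for x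
    using frac_le[of "\<bar>x\<bar>" "\<bar>x\<bar>" 1 L] L that by simp
  have D: "D x = lam * D (x / L)" if x: "\<bar>x\<bar> < e" for x
  proof -
    have "(\<lambda>n. lam * (b n * (x / L) ^ n) + a n * (x / L) ^ n) sums (lam * B (x / L) + g (x / L))"
      using shrink[OF x] a[of "x / L"] by (intro sums_add sums_mult B) simp_all
    moreover have "lam * (b n * (x / L) ^ n) + a n * (x / L) ^ n = b n * x ^ n" for n
    proof -
      have "L ^ n - lam > 0" using Ln[of n] lam by linarith
      moreover have "L ^ n > 0" using L by simp
      ultimately have "L ^ n - lam \<noteq> 0" "L ^ n \<noteq> 0" by linarith+
      then show ?thesis using L by (simp add: b_def power_divide field_simps)
    qed
    ultimately have "B x = lam * B (x / L) + g (x / L)"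
      using sums_unique2[OF B[OF x]] by simp
    then show ?thesis
      using eq[of x] by (simp add: D_def algebra_simps)
  qed
  have D_iter: "D x = lam ^ n * D (x / L ^ n)" if "\<bar>x\<bar> < e" for x n
    using that
  proof (induction n arbitrary: x)
    case (Suc n)
    show ?case
      using D[OF Suc.prems] Suc.IH[OF shrink[OF Suc.prems]] by simp
  qed simp
  have "f x = B x" if x: "\<bar>x\<bar> < e" for x
  proof -
    have "isCont D 0"
      unfolding D_def using f power_series_at_isCont[OF B_series] by (intro continuous_intros)
    then have "(\<lambda>n. D (x / L ^ n)) \<longlonglongrightarrow> D 0"
      using LIMSEQ_divide_realpow_zero[OF L, of x] isCont_tendsto_compose by blast
    moreover have "(\<lambda>n. lam ^ n) \<longlonglongrightarrow> 0"
      using lam by (intro LIMSEQ_power_zero) auto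
    ultimately have "(\<lambda>n. lam ^ n * D (x / L ^ n)) \<longlonglongrightarrow> 0 * D 0"
      by (intro tendsto_mult)
    then have "(\<lambda>n. D x) \<longlonglongrightarrow> 0"
      by (simp add: D_iter[OF x, symmetric])
    then show ?thesis
      by (simp add: D_def LIMSEQ_const_iff)
  qed
  with B show ?thesis
    by (intro power_series_atI[OF e, where a = b]) simp
qed

text \<open>On the line the only basis vector is 1, so multi-indices amount to natural numbers;
  absolute convergence inside the disc turns the ordered sum into an unconditional one.\<close>

lemma real_analytic_on_iff_power_series_at:
  fixes f :: "real \<Rightarrow> real"
  shows "real_analytic_on UNIV f \<longleftrightarrow> (\<forall>x. power_series_at f x)"
proof -
  have bij: "bij_betw (\<lambda>n. \<lambda>c\<in>{1::real}. n :: nat) UNIV ({1} \<rightarrow>\<^sub>E UNIV)"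
  proof (intro bij_betwI')
    show "((\<lambda>c\<in>{1::real}. m) = (\<lambda>c\<in>{1}. n)) = (m = n)" for m n :: nat
      by (auto dest: fun_cong[of _ _ 1])
    show "\<exists>n\<in>UNIV. m = (\<lambda>c\<in>{1}. n)" if "m \<in> {1::real} \<rightarrow>\<^sub>E (UNIV :: nat set)" for m
      using that by (intro bexI[of _ "m 1"] PiE_ext[OF that]) auto
  qed auto
  have iff: "((\<lambda>m. (\<Prod>b\<in>Basis. ((y - x) \<bullet> b) ^ m b) *\<^sub>R a m) has_sum s) (Basis \<rightarrow>\<^sub>E UNIV) \<longleftrightarrow>
      ((\<lambda>n. a (\<lambda>c\<in>{1}. n) * (y - x) ^ n) has_sum s) UNIV"
    for x y s :: real and a :: "(real \<Rightarrow> nat) \<Rightarrow> real"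
    using has_sum_reindex_bij_betw[OF bij, of "\<lambda>m. (\<Prod>b\<in>Basis. ((y - x) \<bullet> b) ^ m b) *\<^sub>R a m" s]
    by (simp add: mult.commute)
  show ?thesis
  proof
    assume f: "real_analytic_on UNIV f"
    show "\<forall>x. power_series_at f x"
    proof
      fix x
      obtain e a where e: "e > 0" and a: "\<And>y. y \<in> ball x e \<Longrightarrow>
          ((\<lambda>m. (\<Prod>b\<in>Basis. ((y - x) \<bullet> b) ^ m b) *\<^sub>R a m) has_sum f y) (Basis \<rightarrow>\<^sub>E UNIV)"
        using f unfolding real_analytic_on_def by (metis Int_UNIV_left UNIV_I)
      show "power_series_at f x"
        by (rule power_series_atI[OF e, where a = "\<lambda>n. a (\<lambda>c\<in>{1}. n)"])
          (use a[unfolded iff] in \<open>auto simp: dist_real_def abs_minus_commute intro: has_sum_imp_sums\<close>)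
    qed
  next
    assume f: "\<forall>x. power_series_at f x"
    show "real_analytic_on UNIV f"
      unfolding real_analytic_on_def Int_UNIV_left
    proof
      fix x
      obtain e a where e: "e > 0" and a: "\<And>y. \<bar>y - x\<bar> < e \<Longrightarrow> (\<lambda>n. a n * (y - x) ^ n) sums f y"
        using f unfolding power_series_at_def by blast
      have "((\<lambda>n. a n * (y - x) ^ n) has_sum f y) UNIV" if "\<bar>y - x\<bar> < e" for y
        using power_series_summable_norm[where e = e, OF a, of "y - x"] that a[OF that]
        by (intro norm_summable_imp_has_sum) auto
      then show "\<exists>e>0. \<exists>a. \<forall>y\<in>ball x e.
          ((\<lambda>m. (\<Prod>b\<in>Basis. ((y - x) \<bullet> b) ^ m b) *\<^sub>R a m) has_sum f y) (Basis \<rightarrow>\<^sub>E UNIV)"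
        unfolding iff using e
        by (intro exI[of _ e] conjI exI[of _ "\<lambda>m. a (m 1)"]) (auto simp: dist_real_def abs_minus_commute)
    qed
  qed
qed

section \<open>Analytic functions of several variables\<close>

lemma real_analytic_on_add:
  assumes "real_analytic_on U f" "real_analytic_on U g"
  shows "real_analytic_on U (\<lambda>x. f x + g x)"
  unfolding real_analytic_on_def
proof
  fix x assume x: "x \<in> U"
  obtain e1 a where 1: "e1 > 0" "\<And>y. y \<in> U \<inter> ball x e1 \<Longrightarrow>
      ((\<lambda>m. (\<Prod>b\<in>Basis. ((y - x) \<bullet> b) ^ m b) *\<^sub>R a m) has_sum f y) (Basis \<rightarrow>\<^sub>E UNIV)"
    using assms(1) x unfolding real_analytic_on_def by meson
  obtain e2 b where 2: "e2 > 0" "\<And>y. y \<in> U \<inter> ball x e2 \<Longrightarrow>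
      ((\<lambda>m. (\<Prod>b\<in>Basis. ((y - x) \<bullet> b) ^ m b) *\<^sub>R b m) has_sum g y) (Basis \<rightarrow>\<^sub>E UNIV)"
    using assms(2) x unfolding real_analytic_on_def by meson
  show "\<exists>e>0. \<exists>a. \<forall>y\<in>U \<inter> ball x e.
      ((\<lambda>m. (\<Prod>b\<in>Basis. ((y - x) \<bullet> b) ^ m b) *\<^sub>R a m) has_sum f y + g y) (Basis \<rightarrow>\<^sub>E UNIV)"
    using 1(1) 2(1) has_sum_add[OF 1(2) 2(2)]
    by (intro exI[of _ "min e1 e2"] conjI exI[of _ "\<lambda>m. a m + b m"]) (auto simp: scaleR_add_right)
qed

text \<open>Only powers of the coordinate along b occur: the one-variable coefficients are placed on
  the multi-indices supported at b, and all others are 0.\<close>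

lemma real_analytic_on_ridge:
  fixes f :: "real \<Rightarrow> real" and b :: "'a::euclidean_space" and u :: "'b::euclidean_space"
  assumes f: "\<And>x. power_series_at f x" and b: "b \<in> Basis"
  shows "real_analytic_on UNIV (\<lambda>p. f (p \<bullet> b) *\<^sub>R u)"
  unfolding real_analytic_on_def Int_UNIV_left
proof
  fix x :: 'a
  obtain e a where e: "e > 0" and a: "\<And>y. \<bar>y - x \<bullet> b\<bar> < e \<Longrightarrow> (\<lambda>n. a n * (y - x \<bullet> b) ^ n) sums f y"
    using f[of "x \<bullet> b"] unfolding power_series_at_def by blast
  define single :: "nat \<Rightarrow> 'a \<Rightarrow> nat" where "single n = (\<lambda>c\<in>Basis. if c = b then n else 0)" for n
  define A where "A m = (if \<forall>c\<in>Basis. c \<noteq> b \<longrightarrow> m c = 0 then a (m b) *\<^sub>R u else 0)" for m :: "'a \<Rightarrow> nat"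
  have inj: "inj single"
    using b by (auto simp: inj_def single_def dest: fun_cong[of _ _ b])
  have single_range: "m \<in> range single" if "m \<in> Basis \<rightarrow>\<^sub>E UNIV" "\<forall>c\<in>Basis. c \<noteq> b \<longrightarrow> m c = 0" for m
  proof -
    have "m = single (m b)"
      using that by (intro PiE_ext[OF that(1)]) (auto simp: single_def)
    then show ?thesis by blast
  qed
  have "((\<lambda>m. (\<Prod>c\<in>Basis. ((y - x) \<bullet> c) ^ m c) *\<^sub>R A m) has_sum f (y \<bullet> b) *\<^sub>R u) (Basis \<rightarrow>\<^sub>E UNIV)"
    if y: "y \<in> ball x e" for y
  proof -
    let ?t = "\<lambda>m. (\<Prod>c\<in>Basis. ((y - x) \<bullet> c) ^ m c) *\<^sub>R A m"
    have "\<bar>(y - x) \<bullet> b\<bar> < e"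
      using Basis_le_norm[OF b, of "y - x"] y by (simp add: dist_norm norm_minus_commute)
    then have yb: "\<bar>y \<bullet> b - x \<bullet> b\<bar> < e" by (simp add: inner_diff_left)
    have "((\<lambda>n. a n * (y \<bullet> b - x \<bullet> b) ^ n) has_sum f (y \<bullet> b)) UNIV"
      using power_series_summable_norm[where e = e, OF a, of "y \<bullet> b - x \<bullet> b"] yb a[OF yb]
      by (intro norm_summable_imp_has_sum) auto
    then have "((\<lambda>n. (a n * (y \<bullet> b - x \<bullet> b) ^ n) *\<^sub>R u) has_sum f (y \<bullet> b) *\<^sub>R u) UNIV"
      by (rule has_sum_bounded_linear[OF bounded_linear_scaleR_left])
    moreover have "?t (single n) = (a n * (y \<bullet> b - x \<bullet> b) ^ n) *\<^sub>R u" for n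
    proof -
      have "(\<Prod>c\<in>Basis. ((y - x) \<bullet> c) ^ single n c) = (\<Prod>c\<in>Basis. if c = b then ((y - x) \<bullet> b) ^ n else 1)"
        by (intro prod.cong) (auto simp: single_def)
      then show ?thesis
        using b by (simp add: A_def single_def inner_diff_left mult.commute)
    qed
    ultimately have "(?t has_sum f (y \<bullet> b) *\<^sub>R u) (range single)"
      by (simp add: has_sum_reindex[OF inj] o_def)
    moreover have "A m = 0" if "m \<in> (Basis \<rightarrow>\<^sub>E UNIV) - range single" for m
      using that single_range by (auto simp: A_def)
    then have "(?t has_sum f (y \<bullet> b) *\<^sub>R u) (range single) \<longleftrightarrow>
        (?t has_sum f (y \<bullet> b) *\<^sub>R u) (Basis \<rightarrow>\<^sub>E UNIV)"
      by (intro has_sum_cong_neutral) (auto simp: single_def)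
    ultimately show ?thesis by blast
  qed
  with e show "\<exists>e>0. \<exists>A. \<forall>y\<in>ball x e.
      ((\<lambda>m. (\<Prod>c\<in>Basis. ((y - x) \<bullet> c) ^ m c) *\<^sub>R A m) has_sum f (y \<bullet> b) *\<^sub>R u) (Basis \<rightarrow>\<^sub>E UNIV)"
    by blast
qed

lemma power_series_at_id: "power_series_at (\<lambda>y. y) x"
proof (rule power_series_atI[OF zero_less_one])
  fix y
  show "(\<lambda>n. (if n = 0 then x else if n = 1 then 1 else 0) * (y - x) ^ n) sums y"
    using sums_finite[of "{0, 1}" "\<lambda>n. (if n = 0 then x else if n = 1 then 1 else 0) * (y - x) ^ n"] by simp
qed

section \<open>The non-wandering set\<close>

lemma continuous_on_Max_image:
  fixes f :: "'i \<Rightarrow> 'a::topological_space \<Rightarrow> real"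
  assumes "finite I" "I \<noteq> {}" "\<And>i. i \<in> I \<Longrightarrow> continuous_on S (f i)"
  shows "continuous_on S (\<lambda>x. Max ((\<lambda>i. f i x) ` I))"
  using assms
proof (induction I rule: finite_ne_induct)
  case (insert i I)
  then have "continuous_on S (\<lambda>x. max (f i x) (Max ((\<lambda>i. f i x) ` I)))"
    by (intro continuous_on_max) auto
  with insert show ?case by simp
qed simp

text \<open>This is the upper envelope of the image of the graph of \<rho> under the skew
  map.\<close>

definition max_transfer :: "int \<Rightarrow> real \<Rightarrow> (circle \<Rightarrow> real) \<Rightarrow> (circle \<Rightarrow> real) \<Rightarrow> circle \<Rightarrow> real" where
  "max_transfer l lam \<tau> \<rho> \<theta> = Max ((\<lambda>\<phi>. lam * \<rho> \<phi> + \<tau> \<phi>) ` {\<phi>. circle_mult l \<phi> = \<theta>})"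

lemma finite_circle_mult_fibre:
  assumes "l > 0"
  shows "finite {\<phi>. circle_mult l \<phi> = \<theta>}"
  using circle_mult_fibre_eq[OF assms] circle_exhaust[of \<theta>] by (metis finite_atLeastLessThan_int finite_imageI)

lemma circle_mult_fibre_nonempty:
  assumes "l > 0"
  shows "{\<phi>. circle_mult l \<phi> = \<theta>} \<noteq> {}"
  using surj_circle_mult[OF assms, of \<theta>] by blast

text \<open>On the line the preimages are given by the continuous branches (x + j) / l, so the
  maximum over a fibre lifts to a maximum of finitely many continuous functions.\<close>

lemma continuous_on_max_transfer:
  assumes l: "l > 0" and \<rho>: "continuous_on UNIV \<rho>" and \<tau>: "continuous_on UNIV \<tau>"
  shows "continuous_on UNIV (max_transfer l lam \<tau> \<rho>)"
proof -
  have "continuous_on UNIV (\<lambda>x. Max ((\<lambda>j. lam * \<rho> (circle_of ((x + of_int j) / of_int l)) +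
      \<tau> (circle_of ((x + of_int j) / of_int l))) ` {0..<l}))"
    using l by (intro continuous_on_Max_image continuous_intros continuous_on_compose2[OF \<rho>]
        continuous_on_compose2[OF \<tau>]) auto
  then show ?thesis
    using l unfolding continuous_on_circle_iff[of "max_transfer l lam \<tau> \<rho>"]
    by (simp add: max_transfer_def circle_mult_fibre_eq image_image)
qed

text \<open>Used with two functions in both orders, this yields the contraction by lam in the
  supremum distance.\<close>

lemma max_transfer_le:
  assumes l: "l > 0" and lam: "0 < lam" and d: "\<And>\<phi>. \<rho> \<phi> \<le> \<sigma> \<phi> + d"
  shows "max_transfer l lam \<tau> \<rho> \<theta> \<le> max_transfer l lam \<tau> \<sigma> \<theta> + lam * d"
proof -
  have "lam * \<rho> \<phi> + \<tau> \<phi> \<le> max_transfer l lam \<tau> \<sigma> \<theta> + lam * d" if "circle_mult l \<phi> = \<theta>" for \<phi>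
  proof -
    have "lam * \<rho> \<phi> \<le> lam * \<sigma> \<phi> + lam * d"
      using d[of \<phi>] lam by (metis distrib_left less_imp_le mult_left_mono)
    moreover have "lam * \<sigma> \<phi> + \<tau> \<phi> \<le> max_transfer l lam \<tau> \<sigma> \<theta>"
      unfolding max_transfer_def using that finite_circle_mult_fibre[OF l] by (intro Max_ge) auto
    ultimately show ?thesis by linarith
  qed
  then show ?thesis
    unfolding max_transfer_def[of l lam \<tau> \<rho>]
    using finite_circle_mult_fibre[OF l] circle_mult_fibre_nonempty[OF l, of \<theta>]
    by (subst Max_le_iff) auto
qed

lemma max_transfer_fixed_point:
  assumes l: "l > 0" and lam: "0 < lam" "lam < 1" and \<tau>: "continuous_on UNIV \<tau>"
  obtains \<rho> where "continuous_on UNIV \<rho>" "max_transfer l lam \<tau> \<rho> = \<rho>"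
proof -
  \<comment> \<open>\<open>Bcontfun\<close> is meaningful only for bounded continuous functions.
    Compactness of the circle supplies the bound, and then the Banach fixed point theorem applies in
    the complete space of such functions.\<close>
  define T where "T f = Bcontfun (max_transfer l lam \<tau> (apply_bcontfun f))" for f
  have apply_T: "apply_bcontfun (T f) = max_transfer l lam \<tau> (apply_bcontfun f)" for f
  proof -
    have cont: "continuous_on UNIV (max_transfer l lam \<tau> (apply_bcontfun f))"
      using l \<tau> by (intro continuous_on_max_transfer) auto
    then obtain M where "\<And>\<theta>. \<bar>max_transfer l lam \<tau> (apply_bcontfun f) \<theta>\<bar> \<le> M"
      using continuous_circle_bounded by metis
    with cont show ?thesis
      unfolding T_def by (intro Bcontfun_inverse bcontfun_normI) auto
  qed
  have "dist (T f) (T g) \<le> lam * dist f g" for f g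
  proof (rule dist_bound)
    fix \<theta>
    have d: "\<bar>apply_bcontfun f \<phi> - apply_bcontfun g \<phi>\<bar> \<le> dist f g" for \<phi>
      using dist_bounded[of f \<phi> g] by (simp add: dist_real_def)
    have "max_transfer l lam \<tau> (apply_bcontfun f) \<theta> \<le> max_transfer l lam \<tau> (apply_bcontfun g) \<theta> + lam * dist f g"
      using d by (intro max_transfer_le l lam) (smt (verit) d)
    moreover have "max_transfer l lam \<tau> (apply_bcontfun g) \<theta> \<le> max_transfer l lam \<tau> (apply_bcontfun f) \<theta> + lam * dist f g"
      using d by (intro max_transfer_le l lam) (smt (verit) d)
    ultimately show "dist (apply_bcontfun (T f) \<theta>) (apply_bcontfun (T g) \<theta>) \<le> lam * dist f g"
      by (simp add: apply_T dist_real_def abs_le_iff)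
  qed
  then obtain f where "T f = f"
    using banach_fix_type[of lam T] lam by auto
  then have "max_transfer l lam \<tau> (apply_bcontfun f) = apply_bcontfun f"
    using apply_T[of f] by simp
  then show ?thesis
    using that continuous_on_apply_bcontfun by blast
qed

text \<open>That the maximum dominates every branch gives the forward inequality; that it is
  attained gives a preimage inside the graph, from which backward orbits are built.\<close>

lemma max_transfer_fixed_pointD:
  assumes l: "l > 0" and fixp: "max_transfer l lam \<tau> \<rho> = \<rho>"
  shows "lam * \<rho> \<theta> + \<tau> \<theta> \<le> \<rho> (circle_mult l \<theta>)"
    and "\<exists>\<phi>. circle_mult l \<phi> = \<theta> \<and> \<rho> \<theta> = lam * \<rho> \<phi> + \<tau> \<phi>"
proof -
  have "lam * \<rho> \<theta> + \<tau> \<theta> \<le> max_transfer l lam \<tau> \<rho> (circle_mult l \<theta>)"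
    unfolding max_transfer_def using finite_circle_mult_fibre[OF l] by (intro Max_ge) auto
  then show "lam * \<rho> \<theta> + \<tau> \<theta> \<le> \<rho> (circle_mult l \<theta>)"
    by (simp add: fixp)
  have "max_transfer l lam \<tau> \<rho> \<theta> \<in> (\<lambda>\<phi>. lam * \<rho> \<phi> + \<tau> \<phi>) ` {\<phi>. circle_mult l \<phi> = \<theta>}"
    unfolding max_transfer_def
    using finite_circle_mult_fibre[OF l] circle_mult_fibre_nonempty[OF l] by (intro Max_in) auto
  then show "\<exists>\<phi>. circle_mult l \<phi> = \<theta> \<and> \<rho> \<theta> = lam * \<rho> \<phi> + \<tau> \<phi>"
    by (auto simp: fixp)
qed

text \<open>V acts as a strict Lyapunov function where it is positive: points near p have values
  between lam * d and d, and from the first step on their values are at most lam * d, so they cannot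
  return.\<close>

lemma nonwandering_set_contracted_le_0:
  fixes V :: "'a::topological_space \<Rightarrow> real"
  assumes V: "continuous_on UNIV V" "\<And>p. V (f p) \<le> lam * V p" and lam: "0 < lam" "lam < 1"
    and p: "p \<in> nonwandering_set f"
  shows "V p \<le> 0"
proof (rule ccontr)
  assume "\<not> V p \<le> 0"
  then have c: "V p > 0" by simp
  \<comment> \<open>The midpoint of V p and V p / lam, which places V p strictly between lam * d and
    d.\<close>
  define d where "d = V p * (1 + 1 / lam) / 2"
  have d: "lam * d < V p" "V p < d"
    using c lam by (simp_all add: d_def field_simps)
  have "lam * d > 0"
    using c lam by (simp add: d_def add_pos_pos)
  have "open {q. lam * d < V q \<and> V q < d}"
    using V(1) by (intro open_Collect_conj open_Collect_less) auto
  then obtain n q where n: "n \<ge> 1" and q: "lam * d < V q" "V q < d" "lam * d < V ((f ^^ n) q)"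
    using p d unfolding nonwandering_set_def by fastforce
  have "V ((f ^^ n) q) \<le> lam ^ n * V q" for n
  proof (induction n)
    case (Suc n)
    have "V ((f ^^ Suc n) q) \<le> lam * V ((f ^^ n) q)"
      using V(2) by simp
    also have "\<dots> \<le> lam * (lam ^ n * V q)"
      using Suc lam by simp
    finally show ?case by simp
  qed simp
  then have "V ((f ^^ n) q) \<le> lam ^ n * V q" .
  also have "\<dots> \<le> lam ^ 1 * V q"
    using n lam q \<open>lam * d > 0\<close> by (intro mult_right_mono power_decreasing) auto
  also have "\<dots> \<le> lam * d"
    using q lam by simp
  finally show False using q by simp
qed

lemma nonwandering_set_conjugate:
  assumes hom: "homeomorphism UNIV UNIV h h'" and conj: "h \<circ> f = g \<circ> h"
  shows "h ` nonwandering_set f = nonwandering_set g"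
proof -
  \<comment> \<open>A continuous semiconjugacy preserves non-wandering points. The types are left
    general so that this applies both to \<open>h\<close> and to its inverse.\<close>
  have sub: "h x \<in> nonwandering_set g"
    if x: "x \<in> nonwandering_set f" and h: "continuous_on UNIV h" and conj: "h \<circ> f = g \<circ> h"
    for h and f :: "'c::topological_space \<Rightarrow> 'c" and g :: "'d::topological_space \<Rightarrow> 'd" and x
    unfolding nonwandering_set_def
  proof (intro CollectI allI impI)
    fix U assume U: "open U \<and> h x \<in> U"
    then have "open (h -` U)"
      using h by (simp add: open_vimage)
    with x U obtain n y where ny: "n \<ge> 1" "h y \<in> U" "h ((f ^^ n) y) \<in> U"
      unfolding nonwandering_set_def by fastforce
    have "h ((f ^^ n) y) = (g ^^ n) (h y)" for n
      using conj by (induction n) (auto simp: fun_eq_iff)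
    with ny show "\<exists>n\<ge>1. (g ^^ n) ` U \<inter> U \<noteq> {}" by auto
  qed
  have inv: "h (h' y) = y" "h' (h x) = x" for x y
    using hom by (simp_all add: homeomorphism_def)
  have "h' \<circ> g = f \<circ> h'"
  proof
    fix y
    have "g y = h (f (h' y))"
      using fun_cong[OF conj, of "h' y"] inv by simp
    then show "(h' \<circ> g) y = (f \<circ> h') y" by (simp add: inv)
  qed
  then have "h' y \<in> nonwandering_set f" if "y \<in> nonwandering_set g" for y
    using sub[OF that, of h' f] hom by (simp add: homeomorphism_def)
  moreover have "h x \<in> nonwandering_set g" if "x \<in> nonwandering_set f" for x
    using sub[OF that _ conj] hom by (simp add: homeomorphism_def)
  ultimately show ?thesis
    by (metis inv(1) image_eqI image_subsetI subsetI subset_antisym)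
qed

section \<open>Iterates of the skew map and bounded backward orbits\<close>

lemma skew_map_simp [simp]: "skew_map l lam \<tau> (\<theta>, t) = (circle_mult l \<theta>, lam * t + \<tau> \<theta>)"
  by (simp add: skew_map_def)

lemma fst_skew_map_funpow: "fst ((skew_map l lam \<tau> ^^ n) p) = (circle_mult l ^^ n) (fst p)"
  by (induction n) (simp_all add: skew_map_def case_prod_unfold)

text \<open>Over a fixed base orbit each step is affine in the fibre with slope lam, and the
  contributions of \<tau> cancel.\<close>

lemma snd_skew_map_funpow_diff:
  "snd ((skew_map l lam \<tau> ^^ n) (\<theta>, s)) - snd ((skew_map l lam \<tau> ^^ n) (\<theta>, t)) = lam ^ n * (s - t)"
proof (induction n)
  case (Suc n)
  have "snd ((skew_map l lam \<tau> ^^ Suc n) (\<theta>, t)) =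
      lam * snd ((skew_map l lam \<tau> ^^ n) (\<theta>, t)) + \<tau> ((circle_mult l ^^ n) \<theta>)" for t
    using fst_skew_map_funpow[of n l lam \<tau> "(\<theta>, t)"] by (simp add: skew_map_def case_prod_unfold)
  then show ?case
    using arg_cong[OF Suc, of "(*) lam"] by (simp add: algebra_simps)
qed simp

text \<open>The number M / (1 - lam) is fixed by t -> lam * t + M, so the bound is preserved by
  every step.\<close>

lemma snd_skew_map_funpow_bound:
  assumes lam: "0 < lam" "lam < 1" and M: "\<And>\<theta>. \<bar>\<tau> \<theta>\<bar> \<le> M"
  shows "\<bar>snd ((skew_map l lam \<tau> ^^ n) p)\<bar> \<le> \<bar>snd p\<bar> + M / (1 - lam)"
proof (induction n)
  case 0
  have "0 \<le> M" using M[of undefined] by linarith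
  with lam show ?case by simp
next
  case (Suc n)
  let ?q = "(skew_map l lam \<tau> ^^ n) p"
  have "\<bar>snd ((skew_map l lam \<tau> ^^ Suc n) p)\<bar> \<le> \<bar>lam * snd ?q\<bar> + \<bar>\<tau> (fst ?q)\<bar>"
    by (simp add: skew_map_def case_prod_unfold)
  also have "\<dots> \<le> lam * (\<bar>snd p\<bar> + M / (1 - lam)) + M"
    using Suc M lam by (intro add_mono) (simp_all add: abs_mult)
  also have "\<dots> = lam * \<bar>snd p\<bar> + M / (1 - lam)"
    using lam by (simp add: field_simps)
  also have "\<dots> \<le> \<bar>snd p\<bar> + M / (1 - lam)"
    using lam by (simp add: mult_left_le_one_le)
  finally show ?case .
qed

text \<open>Some forward iterate of any neighbourhood covers the circle, so it meets the backward orbit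
  in the base; the fibrewise contraction then brings the orbit back.\<close>

lemma bounded_backward_orbit_nonwandering:
  fixes P :: "nat \<Rightarrow> cylinder"
  assumes l: "l \<ge> 2" and lam: "0 < lam" "lam < 1" and \<tau>: "continuous_on UNIV \<tau>"
    and P: "\<And>n. skew_map l lam \<tau> (P (Suc n)) = P n" and M: "\<And>n. \<bar>snd (P n)\<bar> \<le> M"
  shows "P 0 \<in> nonwandering_set (skew_map l lam \<tau>)"
  unfolding nonwandering_set_def
proof (intro CollectI allI impI)
  let ?A = "skew_map l lam \<tau>"
  fix U assume "open U \<and> P 0 \<in> U"
  then obtain V W where V: "open V" "fst (P 0) \<in> V" and W: "open W" "snd (P 0) \<in> W"
    and VW: "V \<times> W \<subseteq> U"
    by (metis open_prod_elim mem_Times_iff)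
  obtain e where e: "e > 0" "\<And>s. dist s (snd (P 0)) < e \<Longrightarrow> s \<in> W"
    using W by (auto simp: open_dist)
  obtain N where N: "N \<ge> 1" "\<And>\<phi>. \<exists>\<psi>\<in>V. (circle_mult l ^^ N) \<psi> = \<phi>"
    using circle_mult_locally_eventually_onto[OF l V] by blast
  obtain K where K: "K > 0" "\<And>\<theta>. \<bar>\<tau> \<theta>\<bar> \<le> K"
    using continuous_circle_bounded[OF \<tau>] by blast
  \<comment> \<open>R bounds the fibre distance between the N-th iterate of \<open>q\<close> and
    \<open>P n\<close> for every n. As N depends only on V, n can be chosen afterwards.\<close>
  define R where "R = \<bar>snd (P 0)\<bar> + K / (1 - lam) + M"
  have "(\<lambda>n. lam ^ n * R) \<longlonglongrightarrow> 0"
    using lam by (intro tendsto_mult_left_zero LIMSEQ_power_zero) auto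
  then obtain n where n: "lam ^ n * R < e"
    using e(1) by (metis eventually_sequentially order_refl order_tendstoD(2))
  have orbit: "(?A ^^ n) (P n) = P 0" for n
    by (induction n) (simp_all add: funpow_swap1 P)
  obtain \<psi> where \<psi>: "\<psi> \<in> V" "(circle_mult l ^^ N) \<psi> = fst (P n)"
    using N by blast
  define q where "q = (\<psi>, snd (P 0))"
  define s where "s = snd ((?A ^^ N) q)"
  have q: "(?A ^^ N) q = (fst (P n), s)"
    by (rule prod_eqI) (simp_all add: s_def fst_skew_map_funpow q_def \<psi>)
  have "\<bar>s\<bar> \<le> \<bar>snd (P 0)\<bar> + K / (1 - lam)"
    using snd_skew_map_funpow_bound[OF lam K(2), where p = q and n = N and l = l] by (simp add: s_def q_def)
  then have "\<bar>s - snd (P n)\<bar> \<le> R"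
    using M[of n] unfolding R_def by linarith
  then have "lam ^ n * \<bar>s - snd (P n)\<bar> \<le> lam ^ n * R"
    using lam by (intro mult_left_mono) auto
  then have "lam ^ n * \<bar>s - snd (P n)\<bar> < e"
    using n by linarith
  \<comment> \<open>The N-th iterate of \<open>q\<close> lies over the same base point as
    \<open>P n\<close>, so n more steps contract their distance by lam ^ n while \<open>P n\<close>
    arrives at \<open>P 0\<close>.\<close>
  moreover have "snd ((?A ^^ n) (fst (P n), s)) - snd (P 0) = lam ^ n * (s - snd (P n))"
    using snd_skew_map_funpow_diff[of n l lam \<tau> "fst (P n)" s "snd (P n)"] orbit[of n] by simp
  ultimately have "snd ((?A ^^ n) (fst (P n), s)) \<in> W"
    using lam by (intro e(2)) (simp add: dist_real_def abs_mult)
  moreover have "fst ((?A ^^ n) (fst (P n), s)) = fst (P 0)"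
    using orbit[of n] by (metis fst_skew_map_funpow fst_conv)
  ultimately have "(?A ^^ (n + N)) q \<in> U"
    using VW V q by (auto simp: funpow_add mem_Times_iff)
  moreover have "q \<in> U"
    using VW W \<psi> by (auto simp: q_def)
  ultimately show "\<exists>n\<ge>1. (?A ^^ n) ` U \<inter> U \<noteq> {}"
    using N by (intro exI[of _ "n + N"]) auto
qed

text \<open>Repeated choice of preimages gives a backward orbit inside the graph, whose heights are
  bounded by compactness.\<close>

lemma backward_invariant_graph_nonwandering:
  assumes l: "l \<ge> 2" and lam: "0 < lam" "lam < 1" and \<tau>: "continuous_on UNIV \<tau>"
    and \<rho>: "continuous_on UNIV \<rho>" "\<And>\<theta>. \<exists>\<phi>. circle_mult l \<phi> = \<theta> \<and> \<rho> \<theta> = lam * \<rho> \<phi> + \<tau> \<phi>"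
  shows "(\<theta>, \<rho> \<theta>) \<in> nonwandering_set (skew_map l lam \<tau>)"
proof -
  obtain g where g: "\<And>\<theta>. circle_mult l (g \<theta>) = \<theta>" "\<And>\<theta>. \<rho> \<theta> = lam * \<rho> (g \<theta>) + \<tau> (g \<theta>)"
    using \<rho>(2) by metis
  obtain M where M: "\<And>\<theta>. \<bar>\<rho> \<theta>\<bar> \<le> M"
    using continuous_circle_bounded[OF \<rho>(1)] by blast
  define P where "P n = ((g ^^ n) \<theta>, \<rho> ((g ^^ n) \<theta>))" for n
  have "P 0 \<in> nonwandering_set (skew_map l lam \<tau>)"
  proof (rule bounded_backward_orbit_nonwandering[OF l lam \<tau>])
    show "skew_map l lam \<tau> (P (Suc n)) = P n" for n
      using g(2)[of "(g ^^ n) \<theta>"] by (simp add: P_def g(1))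
    show "\<bar>snd (P n)\<bar> \<le> M" for n
      by (simp add: P_def M)
  qed
  then show ?thesis by (simp add: P_def)
qed

text \<open>The signed excesses t - \<rho> \<theta> and \<sigma> \<theta> - t are continuous and
  satisfy V (f p) \<le> lam * V p, so they are at most 0 at non-wandering points.\<close>

lemma nonwandering_set_between:
  assumes l: "l \<ge> 2" and lam: "0 < lam" "lam < 1"
    and \<sigma>: "continuous_on UNIV \<sigma>" "\<And>\<theta>. \<sigma> (circle_mult l \<theta>) \<le> lam * \<sigma> \<theta> + \<tau> \<theta>"
    and \<rho>: "continuous_on UNIV \<rho>" "\<And>\<theta>. lam * \<rho> \<theta> + \<tau> \<theta> \<le> \<rho> (circle_mult l \<theta>)"
    and p: "(\<theta>, t) \<in> nonwandering_set (skew_map l lam \<tau>)"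
  shows "\<sigma> \<theta> \<le> t \<and> t \<le> \<rho> \<theta>"
proof -
  have "continuous_on UNIV (\<lambda>p. snd p - \<rho> (fst p))"
    by (intro continuous_intros continuous_on_compose2[OF \<rho>(1)]) auto
  then have "snd (\<theta>, t) - \<rho> (fst (\<theta>, t)) \<le> 0"
    by (rule nonwandering_set_contracted_le_0[OF _ _ lam p])
      (use \<rho>(2) in \<open>auto simp: skew_map_def algebra_simps\<close>)
  moreover
  have "continuous_on UNIV (\<lambda>p. \<sigma> (fst p) - snd p)"
    by (intro continuous_intros continuous_on_compose2[OF \<sigma>(1)]) auto
  then have "\<sigma> (fst (\<theta>, t)) - snd (\<theta>, t) \<le> 0"
    by (rule nonwandering_set_contracted_le_0[OF _ _ lam p])
      (use \<sigma>(2) in \<open>auto simp: skew_map_def algebra_simps\<close>)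
  ultimately show ?thesis by simp
qed

text \<open>An invariant graph serves as both barriers in \<open>nonwandering_set_between\<close>,
  and any base preimage continues a backward orbit within it.\<close>

lemma nonwandering_set_eq_graph_of:
  assumes l: "l \<ge> 2" and lam: "0 < lam" "lam < 1" and \<tau>: "continuous_on UNIV \<tau>"
    and \<mu>: "continuous_on UNIV \<mu>" "solves_functional_eq l lam \<tau> \<mu>"
  shows "nonwandering_set (skew_map l lam \<tau>) = graph_of \<mu>"
proof -
  have eq: "\<mu> (circle_mult l \<theta>) = lam * \<mu> \<theta> + \<tau> \<theta>" for \<theta>
    using \<mu>(2) by (simp add: solves_functional_eq_def algebra_simps)
  have "t = \<mu> \<theta>" if "(\<theta>, t) \<in> nonwandering_set (skew_map l lam \<tau>)" for \<theta> t
    using nonwandering_set_between[OF l lam \<mu>(1) _ \<mu>(1) _ that] eq by fastforce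
  moreover have "(\<theta>, \<mu> \<theta>) \<in> nonwandering_set (skew_map l lam \<tau>)" for \<theta>
  proof (rule backward_invariant_graph_nonwandering[OF l lam \<tau> \<mu>(1)])
    show "\<exists>\<phi>. circle_mult l \<phi> = \<theta> \<and> \<mu> \<theta> = lam * \<mu> \<phi> + \<tau> \<phi>" for \<theta>
      using surj_circle_mult[of l \<theta>] l eq by (metis order_less_le_trans zero_less_numeral)
  qed
  ultimately show ?thesis
    by (auto simp: graph_of_def)
qed

lemma nonwandering_set_boundary:
  assumes l: "l \<ge> 2" and lam: "0 < lam" "lam < 1" and \<tau>: "continuous_on UNIV \<tau>"
  obtains \<sigma> \<rho> where "continuous_on UNIV \<sigma>" "continuous_on UNIV \<rho>"
    "\<And>\<theta>. \<sigma> (circle_mult l \<theta>) \<le> lam * \<sigma> \<theta> + \<tau> \<theta>"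
    "\<And>\<theta>. lam * \<rho> \<theta> + \<tau> \<theta> \<le> \<rho> (circle_mult l \<theta>)"
    "\<And>\<theta>. (\<theta>, \<sigma> \<theta>) \<in> nonwandering_set (skew_map l lam \<tau>)"
    "\<And>\<theta>. (\<theta>, \<rho> \<theta>) \<in> nonwandering_set (skew_map l lam \<tau>)"
    "\<And>\<theta>. rho_minus (nonwandering_set (skew_map l lam \<tau>)) \<theta> = ereal (\<sigma> \<theta>)"
    "\<And>\<theta>. rho_plus (nonwandering_set (skew_map l lam \<tau>)) \<theta> = ereal (\<rho> \<theta>)"
proof -
  let ?\<Omega> = "nonwandering_set (skew_map l lam \<tau>)"
  have l0: "l > 0" using l by simp
  obtain \<rho> where \<rho>: "continuous_on UNIV \<rho>" "max_transfer l lam \<tau> \<rho> = \<rho>"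
    using max_transfer_fixed_point[OF l0 lam \<tau>] by blast
  have "continuous_on UNIV (\<lambda>\<theta>. - \<tau> \<theta>)"
    using \<tau> by (intro continuous_intros)
  \<comment> \<open>The reflection t -> -t exchanges the skew maps of \<tau> and -\<tau>, so the
    negated upper boundary for -\<tau> is the lower boundary for \<tau>.\<close>
  then obtain \<nu> where \<nu>: "continuous_on UNIV \<nu>" "max_transfer l lam (\<lambda>\<theta>. - \<tau> \<theta>) \<nu> = \<nu>"
    using max_transfer_fixed_point[OF l0 lam] by blast
  define \<sigma> where "\<sigma> \<theta> = - \<nu> \<theta>" for \<theta>
  have \<sigma>: "continuous_on UNIV \<sigma>"
    unfolding \<sigma>_def by (intro continuous_intros \<nu>(1))
  have \<sigma>_le: "\<sigma> (circle_mult l \<theta>) \<le> lam * \<sigma> \<theta> + \<tau> \<theta>" for \<theta>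
    using max_transfer_fixed_pointD(1)[OF l0 \<nu>(2), of \<theta>] by (simp add: \<sigma>_def)
  note \<rho>_le = max_transfer_fixed_pointD(1)[OF l0 \<rho>(2)]
  have \<sigma>_in: "(\<theta>, \<sigma> \<theta>) \<in> ?\<Omega>" for \<theta>
  proof (rule backward_invariant_graph_nonwandering[OF l lam \<tau> \<sigma>])
    show "\<exists>\<phi>. circle_mult l \<phi> = \<theta> \<and> \<sigma> \<theta> = lam * \<sigma> \<phi> + \<tau> \<phi>" for \<theta>
      using max_transfer_fixed_pointD(2)[OF l0 \<nu>(2), of \<theta>] by (force simp: \<sigma>_def)
  qed
  have \<rho>_in: "(\<theta>, \<rho> \<theta>) \<in> ?\<Omega>" for \<theta>
    using max_transfer_fixed_pointD(2)[OF l0 \<rho>(2)]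
    by (rule backward_invariant_graph_nonwandering[OF l lam \<tau> \<rho>(1)])
  have between: "\<sigma> \<theta> \<le> t \<and> t \<le> \<rho> \<theta>" if "(\<theta>, t) \<in> ?\<Omega>" for \<theta> t
    using nonwandering_set_between[OF l lam \<sigma> \<sigma>_le \<rho>(1) \<rho>_le that] .
  have "rho_minus ?\<Omega> \<theta> = ereal (\<sigma> \<theta>)" for \<theta>
    unfolding rho_minus_def using \<sigma>_in between by (intro INF_eqI) auto
  moreover have "rho_plus ?\<Omega> \<theta> = ereal (\<rho> \<theta>)" for \<theta>
    unfolding rho_plus_def using \<rho>_in between by (intro SUP_eqI) auto
  ultimately show ?thesis
    using that[OF \<sigma> \<rho>(1) \<sigma>_le \<rho>_le \<sigma>_in \<rho>_in] by blast
qed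

text \<open>The width \<open>\<rho>\<^sup>+ - \<rho>\<^sup>-\<close> shrinks at most by the factor \<open>lam\<close> along orbits, so its zero set is
  closed under preimages of the expanding map, hence dense.\<close>

lemma continuous_solution_of_singleton_fibre:
  assumes l: "l \<ge> 2" and lam: "0 < lam" "lam < 1" and \<tau>: "continuous_on UNIV \<tau>"
    and eq: "rho_plus (nonwandering_set (skew_map l lam \<tau>)) \<theta> =
      rho_minus (nonwandering_set (skew_map l lam \<tau>)) \<theta>"
  obtains \<mu> where "continuous_on UNIV \<mu>" "solves_functional_eq l lam \<tau> \<mu>"
proof -
  let ?\<Omega> = "nonwandering_set (skew_map l lam \<tau>)"
  obtain \<sigma> \<rho> where cont: "continuous_on UNIV \<sigma>" "continuous_on UNIV \<rho>"
    and \<sigma>: "\<And>\<theta>. \<sigma> (circle_mult l \<theta>) \<le> lam * \<sigma> \<theta> + \<tau> \<theta>"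
    and \<rho>: "\<And>\<theta>. lam * \<rho> \<theta> + \<tau> \<theta> \<le> \<rho> (circle_mult l \<theta>)"
    and mem: "\<And>\<theta>. (\<theta>, \<sigma> \<theta>) \<in> ?\<Omega>"
    and rho: "\<And>\<theta>. rho_minus ?\<Omega> \<theta> = ereal (\<sigma> \<theta>)" "\<And>\<theta>. rho_plus ?\<Omega> \<theta> = ereal (\<rho> \<theta>)"
    using nonwandering_set_boundary[OF l lam \<tau>] by metis
  have le: "\<sigma> \<phi> \<le> \<rho> \<phi>" for \<phi>
    using nonwandering_set_between[OF l lam cont(1) \<sigma> cont(2) \<rho> mem] by blast
  \<comment> \<open>Squeeze: lam * \<rho> \<phi> + \<tau> \<phi> \<le> \<rho> (l\<phi>) = \<sigma>
    (l\<phi>) \<le> lam * \<sigma> \<phi> + \<tau> \<phi>.\<close>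
  have step: "\<rho> \<phi> = \<sigma> \<phi>" if "\<rho> (circle_mult l \<phi>) = \<sigma> (circle_mult l \<phi>)" for \<phi>
  proof -
    have "lam * \<rho> \<phi> \<le> lam * \<sigma> \<phi>"
      using \<sigma>[of \<phi>] \<rho>[of \<phi>] that by linarith
    with lam le[of \<phi>] show ?thesis by simp
  qed
  have steps: "\<rho> \<phi> = \<sigma> \<phi>" if "\<rho> ((circle_mult l ^^ n) \<phi>) = \<sigma> ((circle_mult l ^^ n) \<phi>)" for n \<phi>
    using that step by (induction n) auto
  have "\<rho> \<phi> = \<sigma> \<phi>" for \<phi>
  proof (rule ccontr)
    assume "\<rho> \<phi> \<noteq> \<sigma> \<phi>"
    then have "\<phi> \<in> {\<phi>. \<rho> \<phi> \<noteq> \<sigma> \<phi>}" by simp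
    moreover have "open {\<phi>. \<rho> \<phi> \<noteq> \<sigma> \<phi>}"
      using cont by (rule_tac open_Collect_neq)
    \<comment> \<open>The open set where the boundaries differ would contain an iterated preimage of
      \<theta>, at which they agree.\<close>
    ultimately obtain N where "\<And>\<theta>. \<exists>\<psi>\<in>{\<phi>. \<rho> \<phi> \<noteq> \<sigma> \<phi>}. (circle_mult l ^^ N) \<psi> = \<theta>"
      using circle_mult_locally_eventually_onto[OF l] by blast
    then obtain \<psi> where \<psi>: "\<rho> \<psi> \<noteq> \<sigma> \<psi>" "(circle_mult l ^^ N) \<psi> = \<theta>" by blast
    moreover have "\<rho> \<theta> = \<sigma> \<theta>" using eq by (simp add: rho)
    ultimately show False using steps[of N \<psi>] by simp
  qed
  then have "\<rho> (circle_mult l \<phi>) = lam * \<rho> \<phi> + \<tau> \<phi>" for \<phi>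
    using \<sigma>[of \<phi>] \<rho>[of \<phi>] by simp
  then have "solves_functional_eq l lam \<tau> \<rho>"
    by (simp add: solves_functional_eq_def)
  with cont(2) show ?thesis by (rule that)
qed

text \<open>The upper graph is a continuous injective image of the circle inside a Jordan curve,
  hence all of it; a lower boundary point is therefore also an upper one, over the same base
  point.\<close>

lemma jordan_curve_singleton_fibre:
  assumes l: "l \<ge> 2" and lam: "0 < lam" "lam < 1" and \<tau>: "continuous_on UNIV \<tau>"
    and jordan: "jordan_curve (nonwandering_set (skew_map l lam \<tau>))"
  shows "\<exists>\<theta>. rho_plus (nonwandering_set (skew_map l lam \<tau>)) \<theta> =
    rho_minus (nonwandering_set (skew_map l lam \<tau>)) \<theta>"
proof (rule ccontr)
  assume neq: "\<not> ?thesis"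
  let ?\<Omega> = "nonwandering_set (skew_map l lam \<tau>)"
  obtain \<sigma> \<rho> where cont: "continuous_on UNIV \<rho>"
    and mem: "\<And>\<theta>. (\<theta>, \<sigma> \<theta>) \<in> ?\<Omega>" "\<And>\<theta>. (\<theta>, \<rho> \<theta>) \<in> ?\<Omega>"
    and rho: "\<And>\<theta>. rho_minus ?\<Omega> \<theta> = ereal (\<sigma> \<theta>)" "\<And>\<theta>. rho_plus ?\<Omega> \<theta> = ereal (\<rho> \<theta>)"
    using nonwandering_set_boundary[OF l lam \<tau>] by metis
  obtain h h' where hom: "homeomorphism ?\<Omega> (sphere (0::complex) 1) h h'"
    using jordan by (auto simp: jordan_curve_def homeomorphic_def)
  then have h: "continuous_on ?\<Omega> h" "h ` ?\<Omega> = sphere 0 1" "inj_on h ?\<Omega>"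
    by (auto simp: homeomorphism_def intro: inj_on_inverseI)
  define \<Phi> where "\<Phi> \<theta> = h (\<theta>, \<rho> \<theta>)" for \<theta>
  have "continuous_on UNIV \<Phi>"
    unfolding \<Phi>_def by (intro continuous_on_compose2[OF h(1)] continuous_intros cont) (use mem in auto)
  moreover have "inj \<Phi>"
    using h(3) mem(2) by (auto simp: \<Phi>_def inj_on_def)
  moreover have "norm (\<Phi> \<theta>) = 1" for \<theta>
    using h(2) mem(2) by (force simp: \<Phi>_def)
  \<comment> \<open>Here \<open>undefined\<close> stands for an arbitrary base point.\<close>
  moreover have "norm (h (undefined, \<sigma> undefined)) = 1"
    using h(2) mem(1) by force
  ultimately have "h (undefined, \<sigma> undefined) \<in> range \<Phi>"
    by (rule inj_continuous_circle_to_sphere_surj)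
  then obtain \<theta> where "h (undefined, \<sigma> undefined) = h (\<theta>, \<rho> \<theta>)"
    by (auto simp: \<Phi>_def)
  then have "(undefined, \<sigma> undefined) = (\<theta>, \<rho> \<theta>)"
    using inj_onD[OF h(3)] mem by blast
  then have "\<rho> undefined = \<sigma> undefined" by auto
  with neq rho show False by simp
qed

section \<open>Graphs and topological conjugacy\<close>

lemma rho_plus_eq_rho_minus_graph_of: "rho_plus (graph_of \<mu>) \<theta> = rho_minus (graph_of \<mu>) \<theta>"
proof -
  have "{t. (\<theta>, t) \<in> graph_of \<mu>} = {\<mu> \<theta>}"
    by (auto simp: graph_of_def)
  then show ?thesis by (simp add: rho_plus_def rho_minus_def)
qed

lemma jordan_curve_graph_of:
  fixes \<mu> :: "circle \<Rightarrow> real"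
  assumes "continuous_on UNIV \<mu>"
  shows "jordan_curve (graph_of \<mu>)"
proof -
  have "homeomorphism (graph_of \<mu>) UNIV fst (\<lambda>\<theta>. (\<theta>, \<mu> \<theta>))"
    using assms by (auto simp: homeomorphism_def graph_of_def image_iff intro!: continuous_intros)
  then have "graph_of \<mu> homeomorphic (UNIV :: circle set)"
    by (auto simp: homeomorphic_def)
  then show ?thesis
    unfolding jordan_curve_def using circle_homeomorphic_sphere by (rule homeomorphic_trans)
qed

text \<open>For \<tau> = 0 the zero function solves the equation, so the non-wandering set is the
  zero section; a conjugacy restricts to a homeomorphism onto it.\<close>

lemma jordan_curve_of_topologically_conjugate:
  assumes l: "l \<ge> 2" and lam: "0 < lam" "lam < 1"
    and conj: "topologically_conjugate (skew_map l lam \<tau>) (skew_map l lam (\<lambda>_. 0))"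
  shows "jordan_curve (nonwandering_set (skew_map l lam \<tau>))"
proof -
  let ?\<Omega> = "nonwandering_set (skew_map l lam \<tau>)"
  have zero: "nonwandering_set (skew_map l lam (\<lambda>_. 0)) = graph_of (\<lambda>_ :: circle. 0 :: real)"
    by (rule nonwandering_set_eq_graph_of[OF l lam]) (auto simp: solves_functional_eq_def)
  obtain h h' where hom: "homeomorphism UNIV UNIV h h'"
    and h: "h \<circ> skew_map l lam \<tau> = skew_map l lam (\<lambda>_. 0) \<circ> h"
    using conj by (auto simp: topologically_conjugate_def)
  have "h ` ?\<Omega> = graph_of (\<lambda>_ :: circle. 0 :: real)"
    using nonwandering_set_conjugate[OF hom h] zero by simp
  then have "homeomorphism ?\<Omega> (graph_of (\<lambda>_ :: circle. 0 :: real)) h h'"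
    by (rule_tac homeomorphism_of_subsets[OF hom]) auto
  then have "?\<Omega> homeomorphic graph_of (\<lambda>_ :: circle. 0 :: real)"
    by (auto simp: homeomorphic_def)
  moreover have "graph_of (\<lambda>_ :: circle. 0 :: real) homeomorphic sphere (0::complex) 1"
    using jordan_curve_graph_of[of "\<lambda>_ :: circle. 0 :: real"] by (simp add: jordan_curve_def)
  ultimately show ?thesis
    unfolding jordan_curve_def by (rule homeomorphic_trans)
qed

section \<open>Regularity classes on the circle and the cylinder\<close>

text \<open>The function f has a power series at 0, hence at all nearby points; the equation carries
  this property from x / L to x.\<close>

lemma real_analytic_on_solution:
  fixes f g :: "real \<Rightarrow> real"
  assumes lam: "0 < lam" "lam < 1" and L: "L > 1"
    and eq: "\<And>x. f x = lam * f (x / L) + g (x / L)" and f: "continuous_on UNIV f"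
    and g: "real_analytic_on UNIV g"
  shows "real_analytic_on UNIV f"
proof -
  have g_at: "power_series_at g x" for x
    using g by (simp add: real_analytic_on_iff_power_series_at)
  have "power_series_at f 0"
    using f by (intro power_series_at_0_solution[OF lam L eq _ g_at])
      (simp add: continuous_on_eq_continuous_at)
  then obtain e where e: "e > 0" "\<And>y. \<bar>y - 0\<bar> < e \<Longrightarrow> power_series_at f y"
    using power_series_at_nearby by blast
  have "power_series_at f x" for x
  proof (rule scaling_induct[OF L e(1)])
    show "power_series_at f x" if "\<bar>x\<bar> < e" for x
      using e(2)[of x] that by simp
    show "power_series_at f x" if "power_series_at f (x / L)" for x
    proof -
      have "power_series_at (\<lambda>y. lam * f (y / L) + 1 * g (y / L)) x"
        using L by (intro power_series_at_add power_series_at_scale that g_at) auto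
      moreover have "(\<lambda>y. lam * f (y / L) + 1 * g (y / L)) = f"
        by (rule ext) (metis eq mult_1)
      ultimately show ?thesis by simp
    qed
  qed
  then show ?thesis
    by (simp add: real_analytic_on_iff_power_series_at)
qed

lemma circle_fun_of_class_imp_continuous_on:
  assumes "circle_fun_of_class \<C> f"
  shows "continuous_on UNIV f"
proof (cases \<C>)
  case Lipschitz
  then show ?thesis
    using assms lipschitz_on_continuous_on by auto
next
  case (C_ext r)
  then show ?thesis
    using assms C_ext_on_imp_continuous_on[of r UNIV "f \<circ> circle_of"]
    by (simp add: continuous_on_circle_iff o_def)
next
  case C_omega
  then have "isCont (f \<circ> circle_of) x" for x
    using assms power_series_at_isCont by (auto simp: real_analytic_on_iff_power_series_at)
  then show ?thesis
    by (simp add: continuous_on_circle_iff o_def continuous_at_imp_continuous_on)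
qed

text \<open>Evaluating the lifted equation at x / l puts it in the contracted form treated on the
  line, where each class has its own argument.\<close>

lemma circle_fun_of_class_solution:
  assumes l: "l \<ge> 2" and lam: "0 < lam" "lam < 1"
    and \<tau>: "circle_fun_of_class \<C> \<tau>"
    and \<mu>: "continuous_on UNIV \<mu>" "solves_functional_eq l lam \<tau> \<mu>"
  shows "circle_fun_of_class \<C> \<mu>"
proof -
  define L where "L = real_of_int l"
  define f where "f = \<mu> \<circ> circle_of"
  define g where "g = \<tau> \<circ> circle_of"
  have L: "L > 1" using l by (simp add: L_def)
  have eq: "f x = lam * f (x / L) + g (x / L)" for x
  proof -
    have "\<mu> (circle_mult l (circle_of (x / L))) = lam * \<mu> (circle_of (x / L)) + \<tau> (circle_of (x / L))"
      using \<mu>(2)[unfolded solves_functional_eq_def, rule_format, of "circle_of (x / L)"] by linarith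
    then show ?thesis
      using l by (simp add: f_def g_def L_def)
  qed
  have f: "continuous_on UNIV f"
    using \<mu>(1) by (simp add: f_def continuous_on_circle_iff o_def)
  show ?thesis
  proof (cases \<C>)
    case Lipschitz
    then obtain C where C: "C-lipschitz_on UNIV \<tau>"
      using \<tau> by auto
    have C0: "C \<ge> 0" using C by (rule lipschitz_on_nonneg)
    obtain M where M: "\<And>\<theta>. \<bar>\<mu> \<theta>\<bar> \<le> M"
      using continuous_circle_bounded[OF \<mu>(1)] by blast
    have g_lip: "\<bar>g x - g y\<bar> \<le> C * \<bar>x - y\<bar> powr 1" for x y
    proof -
      have "\<bar>g x - g y\<bar> \<le> C * dist (circle_of x) (circle_of y)"
        using lipschitz_onD[OF C, of "circle_of x" "circle_of y"] by (simp add: g_def dist_real_def)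
      also have "\<dots> \<le> C * dist x y"
        using dist_circle_of_le C0 by (rule mult_left_mono)
      finally show ?thesis by (simp add: dist_real_def)
    qed
    have f_bound: "\<bar>f x\<bar> \<le> M" for x by (simp add: f_def M)
    have "\<bar>f x - f y\<bar> \<le> C / (1 - lam) * \<bar>x - y\<bar> powr 1" for x y
      by (rule holder_solution[where f = f and g = g and S = UNIV, OF lam L _ C0 eq _ f_bound g_lip]) auto
    then have f_lip: "\<bar>f x - f y\<bar> \<le> C / (1 - lam) * \<bar>x - y\<bar>" for x y
      by simp
    have "(C / (1 - lam))-lipschitz_on UNIV \<mu>"
    proof (rule lipschitz_onI)
      fix \<theta> \<phi>
      \<comment> \<open>Only for closest representatives does the bound on the line read as a bound
        by the distance on the circle.\<close>
      obtain x y where "\<theta> = circle_of x" "\<phi> = circle_of y" "dist \<theta> \<phi> = dist x y"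
        by (rule circle_dist_attained)
      then show "dist (\<mu> \<theta>) (\<mu> \<phi>) \<le> C / (1 - lam) * dist \<theta> \<phi>"
        using f_lip[of x y] by (simp add: f_def dist_real_def)
    qed (use C0 lam in auto)
    then show ?thesis using Lipschitz by auto
  next
    case (C_ext r)
    then have "C_ext_on r UNIV g"
      using \<tau> by (simp add: g_def)
    then have "C_ext_on r UNIV f"
      by (rule C_ext_on_solution[OF lam L eq f])
    then show ?thesis
      using C_ext by (simp add: f_def)
  next
    case C_omega
    then have "real_analytic_on UNIV g"
      using \<tau> by (simp add: g_def)
    then have "real_analytic_on UNIV f"
      by (rule real_analytic_on_solution[OF lam L eq f])
    then show ?thesis
      using C_omega by (simp add: f_def)
  qed
qed

section \<open>The conjugacy given by a solution\<close>

definition fibre_translation :: "(circle \<Rightarrow> real) \<Rightarrow> cylinder \<Rightarrow> cylinder" where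
  "fibre_translation \<mu> = (\<lambda>(\<theta>, t). (\<theta>, t + \<mu> \<theta>))"

text \<open>The scalar c lets c = -1 and c = 1 cover the conjugacy and its inverse.\<close>

lemma cyl_map_of_class_fibre_translation:
  assumes \<mu>: "circle_fun_of_class \<C> \<mu>"
  shows "cyl_map_of_class \<C> (fibre_translation (\<lambda>\<theta>. c * \<mu> \<theta>))"
proof -
  define f where "f = \<mu> \<circ> circle_of"
  \<comment> \<open>A global lift to the plane that serves as the chart form at every point, written
    as constant plus linear map plus ridge function to fit \<open>C_ext_on_ridge\<close>.\<close>
  define F :: "real \<times> real \<Rightarrow> real \<times> real" where "F p = 0 + p + f (fst p) *\<^sub>R (0, c)" for p
  have F: "fibre_translation (\<lambda>\<theta>. c * \<mu> \<theta>) (cyl_of q) = cyl_of (F q)" for q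
    by (cases q) (simp add: fibre_translation_def cyl_of_def F_def f_def mult.commute)
  have charts: "in_charts P (fibre_translation (\<lambda>\<theta>. c * \<mu> \<theta>))" if "P UNIV F" for P
    unfolding in_charts_def using that F by (intro allI exI[of _ UNIV] exI[of _ F]) auto
  show ?thesis
  proof (cases \<C>)
    case Lipschitz
    then obtain C where C: "C-lipschitz_on UNIV \<mu>"
      using \<mu> by auto
    have C0: "C \<ge> 0" using C by (rule lipschitz_on_nonneg)
    \<comment> \<open>The base and fibre distances are each at most \<open>dist p q\<close>, whence
      the 2; the rest comes from the translation term.\<close>
    have "(2 + \<bar>c\<bar> * C)-lipschitz_on UNIV (fibre_translation (\<lambda>\<theta>. c * \<mu> \<theta>))"
    proof (rule lipschitz_onI)
      fix p q :: cylinder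
      obtain \<theta> s \<phi> t where pq: "p = (\<theta>, s)" "q = (\<phi>, t)"
        by (cases p, cases q) blast
      have d: "dist \<theta> \<phi> \<le> dist p q" "dist s t \<le> dist p q"
        using dist_fst_le[of p q] dist_snd_le[of p q] by (simp_all add: pq)
      have "dist (s + c * \<mu> \<theta>) (t + c * \<mu> \<phi>) \<le> dist s t + dist (c * \<mu> \<theta>) (c * \<mu> \<phi>)"
        by (rule dist_triangle_add)
      also have "dist (c * \<mu> \<theta>) (c * \<mu> \<phi>) = \<bar>c\<bar> * dist (\<mu> \<theta>) (\<mu> \<phi>)"
        by (simp add: dist_real_def abs_mult flip: right_diff_distrib)
      also have "\<dots> \<le> \<bar>c\<bar> * (C * dist \<theta> \<phi>)"
        using lipschitz_onD[OF C, of \<theta> \<phi>] by (intro mult_left_mono) auto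
      also have "\<dots> \<le> \<bar>c\<bar> * (C * dist p q)"
        using d C0 by (intro mult_left_mono) auto
      finally have t: "dist (s + c * \<mu> \<theta>) (t + c * \<mu> \<phi>) \<le> dist s t + \<bar>c\<bar> * (C * dist p q)"
        by simp
      have "dist (fibre_translation (\<lambda>\<theta>. c * \<mu> \<theta>) p) (fibre_translation (\<lambda>\<theta>. c * \<mu> \<theta>) q)
          \<le> dist \<theta> \<phi> + dist (s + c * \<mu> \<theta>) (t + c * \<mu> \<phi>)"
        by (simp add: pq fibre_translation_def dist_Pair_Pair sqrt_sum_squares_le_sum)
      also have "\<dots> \<le> (2 + \<bar>c\<bar> * C) * dist p q"
        using t d by (simp add: algebra_simps)
      finally show "dist (fibre_translation (\<lambda>\<theta>. c * \<mu> \<theta>) p) (fibre_translation (\<lambda>\<theta>. c * \<mu> \<theta>) q)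
          \<le> (2 + \<bar>c\<bar> * C) * dist p q" .
    qed (use C0 in auto)
    then show ?thesis using Lipschitz by auto
  next
    case (C_ext r)
    then have "C_ext_on r UNIV f"
      using \<mu> by (simp add: f_def)
    then have "C_ext_on r UNIV F"
      unfolding F_def by (intro C_ext_on_ridge[OF bounded_linear_fst bounded_linear_ident])
    then show ?thesis
      using C_ext charts by simp
  next
    case C_omega
    then have f: "power_series_at f x" for x
      using \<mu> by (simp add: f_def real_analytic_on_iff_power_series_at)
    have Basis: "(1, 0) \<in> (Basis :: (real \<times> real) set)" "(0, 1) \<in> (Basis :: (real \<times> real) set)"
      by (auto simp: Basis_prod_def)
    \<comment> \<open>The identity is split along the coordinate vectors, so that every summand is
      an analytic ridge function.\<close>
    have "real_analytic_on UNIV (\<lambda>p :: real \<times> real. (p \<bullet> (1, 0)) *\<^sub>R (1 :: real, 0 :: real) +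
        (p \<bullet> (0, 1)) *\<^sub>R (0, 1) + f (p \<bullet> (1, 0)) *\<^sub>R (0, c))"
      by (intro real_analytic_on_add real_analytic_on_ridge[OF power_series_at_id]
          real_analytic_on_ridge[OF f] Basis)
    also have "(\<lambda>p :: real \<times> real. (p \<bullet> (1, 0)) *\<^sub>R (1 :: real, 0 :: real) +
        (p \<bullet> (0, 1)) *\<^sub>R (0, 1) + f (p \<bullet> (1, 0)) *\<^sub>R (0, c)) = F"
      by (auto simp: F_def)
    finally show ?thesis
      using C_omega charts by simp
  qed
qed

text \<open>Subtracting \<mu> straightens the invariant graph: lam * t + \<tau> \<theta> - \<mu>
  (l\<theta>) = lam * (t - \<mu> \<theta>).\<close>

lemma conjugate_of_class_solution:
  assumes \<mu>: "circle_fun_of_class \<C> \<mu>" "solves_functional_eq l lam \<tau> \<mu>"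
  shows "conjugate_of_class \<C> (skew_map l lam \<tau>) (skew_map l lam (\<lambda>_. 0))"
proof -
  let ?h = "fibre_translation (\<lambda>\<theta>. - 1 * \<mu> \<theta>)" and ?h' = "fibre_translation (\<lambda>\<theta>. 1 * \<mu> \<theta>)"
  have cont: "continuous_on UNIV (fibre_translation (\<lambda>\<theta>. c * \<mu> \<theta>))" for c
    unfolding fibre_translation_def case_prod_unfold
    by (intro continuous_intros continuous_on_compose2[OF circle_fun_of_class_imp_continuous_on[OF \<mu>(1)]]) auto
  have inv: "?h' (?h p) = p" "?h (?h' p) = p" for p
    by (simp_all add: fibre_translation_def case_prod_unfold)
  have "homeomorphism UNIV UNIV ?h ?h'"
    by (intro homeomorphismI cont) (use inv in auto)
  moreover have "?h \<circ> skew_map l lam \<tau> = skew_map l lam (\<lambda>_. 0) \<circ> ?h"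
  proof
    fix p :: cylinder
    obtain \<theta> t where p: "p = (\<theta>, t)" by (cases p)
    have "\<mu> (circle_mult l \<theta>) - lam * \<mu> \<theta> = \<tau> \<theta>"
      using \<mu>(2) by (simp add: solves_functional_eq_def)
    then show "(?h \<circ> skew_map l lam \<tau>) p = (skew_map l lam (\<lambda>_. 0) \<circ> ?h) p"
      by (simp add: p fibre_translation_def algebra_simps)
  qed
  ultimately show ?thesis
    unfolding conjugate_of_class_def using cyl_map_of_class_fibre_translation[OF \<mu>(1)] by blast
qed

section \<open>The equivalences\<close>

theorem proposition3p1:
  fixes l :: int and lam :: real and \<C> :: regularity and \<tau> :: "circle \<Rightarrow> real"
  assumes "l \<ge> 2" and "0 < lam" and "lam < 1" and "circle_fun_of_class \<C> \<tau>"
  defines "A \<equiv> skew_map l lam \<tau>"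
    and "A\<^sub>0 \<equiv> skew_map l lam (\<lambda>_. 0)"
    and "\<Omega> \<equiv> nonwandering_set (skew_map l lam \<tau>)"
  shows "(topologically_conjugate A A\<^sub>0 \<longleftrightarrow> conjugate_of_class \<C> A A\<^sub>0) \<and>
    (topologically_conjugate A A\<^sub>0 \<longleftrightarrow> (\<exists>\<mu>. continuous_on UNIV \<mu> \<and> \<Omega> = graph_of \<mu>)) \<and>
    (topologically_conjugate A A\<^sub>0 \<longleftrightarrow> (\<exists>\<mu>. circle_fun_of_class \<C> \<mu> \<and> \<Omega> = graph_of \<mu>)) \<and>
    (topologically_conjugate A A\<^sub>0 \<longleftrightarrow>
       (\<exists>\<mu>. continuous_on UNIV \<mu> \<and> solves_functional_eq l lam \<tau> \<mu>)) \<and>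
    (topologically_conjugate A A\<^sub>0 \<longleftrightarrow>
       (\<exists>\<mu>. circle_fun_of_class \<C> \<mu> \<and> solves_functional_eq l lam \<tau> \<mu>)) \<and>
    (topologically_conjugate A A\<^sub>0 \<longleftrightarrow> (\<forall>\<theta>. rho_plus \<Omega> \<theta> = rho_minus \<Omega> \<theta>)) \<and>
    (topologically_conjugate A A\<^sub>0 \<longleftrightarrow> (\<exists>\<theta>. rho_plus \<Omega> \<theta> = rho_minus \<Omega> \<theta>)) \<and>
    (topologically_conjugate A A\<^sub>0 \<longleftrightarrow> jordan_curve \<Omega>)"
proof -
  note l = assms(1) and lam = assms(2,3) and \<tau> = assms(4)
  have \<tau>_cont: "continuous_on UNIV \<tau>"
    using \<tau> by (rule circle_fun_of_class_imp_continuous_on)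
  \<comment> \<open>Naming the nine statements reduces the conclusion to propositional reasoning
    from the ten implications that follow.\<close>
  define top_conj where "top_conj \<longleftrightarrow> topologically_conjugate A A\<^sub>0"
  define class_conj where "class_conj \<longleftrightarrow> conjugate_of_class \<C> A A\<^sub>0"
  define cont_graph where "cont_graph \<longleftrightarrow> (\<exists>\<mu>. continuous_on UNIV \<mu> \<and> \<Omega> = graph_of \<mu>)"
  define class_graph where "class_graph \<longleftrightarrow> (\<exists>\<mu>. circle_fun_of_class \<C> \<mu> \<and> \<Omega> = graph_of \<mu>)"
  define cont_sol where "cont_sol \<longleftrightarrow> (\<exists>\<mu>. continuous_on UNIV \<mu> \<and> solves_functional_eq l lam \<tau> \<mu>)"
  define class_sol where "class_sol \<longleftrightarrow> (\<exists>\<mu>. circle_fun_of_class \<C> \<mu> \<and> solves_functional_eq l lam \<tau> \<mu>)"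
  define all_eq where "all_eq \<longleftrightarrow> (\<forall>\<theta>. rho_plus \<Omega> \<theta> = rho_minus \<Omega> \<theta>)"
  define some_eq where "some_eq \<longleftrightarrow> (\<exists>\<theta>. rho_plus \<Omega> \<theta> = rho_minus \<Omega> \<theta>)"
  define jordan where "jordan \<longleftrightarrow> jordan_curve \<Omega>"
  have 1: "top_conj \<Longrightarrow> jordan"
    unfolding top_conj_def jordan_def A_def A\<^sub>0_def \<Omega>_def
    by (rule jordan_curve_of_topologically_conjugate[OF l lam])
  have 2: "jordan \<Longrightarrow> some_eq"
    unfolding jordan_def some_eq_def \<Omega>_def by (rule jordan_curve_singleton_fibre[OF l lam \<tau>_cont])
  have 3: "some_eq \<Longrightarrow> cont_sol"
    unfolding some_eq_def cont_sol_def \<Omega>_def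
    using continuous_solution_of_singleton_fibre[OF l lam \<tau>_cont] by metis
  have 4: "cont_sol \<Longrightarrow> class_sol"
    unfolding cont_sol_def class_sol_def using circle_fun_of_class_solution[OF l lam \<tau>] by blast
  have 5: "class_sol \<Longrightarrow> class_conj"
    unfolding class_sol_def class_conj_def A_def A\<^sub>0_def using conjugate_of_class_solution by blast
  have 6: "class_conj \<Longrightarrow> top_conj"
    unfolding class_conj_def top_conj_def conjugate_of_class_def topologically_conjugate_def by blast
  have 7: "class_sol \<Longrightarrow> class_graph"
    unfolding class_sol_def class_graph_def \<Omega>_def
    using nonwandering_set_eq_graph_of[OF l lam \<tau>_cont circle_fun_of_class_imp_continuous_on] by blast
  have 8: "class_graph \<Longrightarrow> cont_graph"
    unfolding class_graph_def cont_graph_def using circle_fun_of_class_imp_continuous_on by blast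
  have 9: "cont_graph \<Longrightarrow> all_eq"
    unfolding cont_graph_def all_eq_def using rho_plus_eq_rho_minus_graph_of by metis
  have 10: "all_eq \<Longrightarrow> some_eq"
    unfolding all_eq_def some_eq_def by blast
  have "(top_conj \<longleftrightarrow> class_conj) \<and> (top_conj \<longleftrightarrow> cont_graph) \<and> (top_conj \<longleftrightarrow> class_graph) \<and>
      (top_conj \<longleftrightarrow> cont_sol) \<and> (top_conj \<longleftrightarrow> class_sol) \<and> (top_conj \<longleftrightarrow> all_eq) \<and>
      (top_conj \<longleftrightarrow> some_eq) \<and> (top_conj \<longleftrightarrow> jordan)"
    using 1 2 3 4 5 6 7 8 9 10 by blast
  then show ?thesis
    unfolding top_conj_def class_conj_def cont_graph_def class_graph_def cont_sol_def class_sol_def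
      all_eq_def some_eq_def jordan_def .
qed

end
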